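(* Let $d\ge 1$ and let $\phi:[0,\pi]\to\mathbb{R}$ be a function with expansion $\phi(d(x,y))=\sum_{n\ge0}a_nC_n(xy)$, where $a_n>0$ for all $n\ge 0$ and $\sum_{n\ge0}d_na_n<\infty$. Let $N$ be a fixed positive integer and let $Y\subset\mathcal{S}^d$ be a finite set of points with fill-distance $h(Y,\mathcal{S}^d)\le 1/(2N)$. Let $f\in\mathcal{H}_\phi$ and let $S_\phi^Y$ be the $\phi$-spline interpolant to $f$ on $Y$. Let $\Lambda$ be the pseudodifferential operator on $\mathcal{S}^d$ with symbol $\lambda_n=(n(d+n-2))^s$, $n\ge0$, for some $s>0$, and suppose that $$\sum_{n\ge0}d_n\lambda_n^2a_n<\infty.$$ Let $E$ be a constant, independent of $n$, such that $\|\Lambda p\|_{L_\infty(\mathcal{S}^d)}\le E\lambda_n\|p\|_{L_\infty(\mathcal{S}^d)}$ for all $n\ge 0$ and all $p\in P_n$. Then, for every $x\in\mathcal{S}^d$, $$|\Lambda(f-S_\phi^Y)(x)|\le(1+2E)\Bigl(\sum_{n\ge N}d_n\lambda_n^2a_n\Bigr)^{1/2}\|f-S_\phi^Y\|_\phi.$$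
   Context: $\mathcal{S}^d=\{x\in\mathbb{R}^{d+1}:|x|=1\}$; $xy$ denotes the Euclidean inner product of $x,y\in\mathbb{R}^{d+1}$; $d(x,y)=\cos^{-1}(xy)$ is the geodesic distance; $\nu$ is the normalised rotationally invariant measure on $\mathcal{S}^d$ (total mass 1), and $L_2(\mathcal{S}^d)$ is taken with respect to $\nu$. The fill-distance of a finite set $Y\subset\mathcal{S}^d$ is $h(Y,\mathcal{S}^d)=\sup_{x\in\mathcal{S}^d}\min_{y\in Y}d(x,y)$. $P_n$ is the space of polynomials of degree at most $n$ on $\mathbb{R}^{d+1}$ restricted to $\mathcal{S}^d$. $H_n=P_n\cap P_{n-1}^\perp$ (orthogonal complement in $L_2(\mathcal{S}^d)$, with $P_{-1}=\{0\}$) is the space of spherical harmonics of degree $n$, $d_n=\dim H_n$, and $Y_1^n,\dots,Y_{d_n}^n$ is an orthonormal basis of $H_n$, so $L_2(\mathcal{S}^d)=\bigoplus_{n\ge0}H_n$. $T_n$ is the orthogonal projector of $L_2(\mathcal{S}^d)$ onto $H_n$. $C_n$ is the Gegenbauer polynomial of degree $n$ normalised so that $C_n(xy)=\sum_{j=1}^{d_n}Y_j^n(x)Y_j^n(y)$; thus $C_n(xy)$ is the kernel of $T_n$. The native space is $\mathcal{H}_\phi=\{f\in L_2(\mathcal{S}^d):\|f\|_\phi:=(\sum_{n\ge0}a_n^{-1}\|T_nf\|_{L_2(\mathcal{S}^d)}^2)^{1/2}<\infty\}$; its elements are identified with their continuous representatives. The $\phi$-spline interpolant to $f$ on $Y$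 is the function $S_\phi^Y(x)=\sum_{y\in Y}\alpha_y\phi(d(x,y))$ with coefficients $\alpha_y\in\mathbb{R}$ determined by $S_\phi^Y(y)=f(y)$ for all $y\in Y$. A pseudodifferential operator $\Lambda$ on $\mathcal{S}^d$ with symbol $\{\lambda_n\}_{n\ge0}$ acts by $\Lambda p_n=\lambda_np_n$ for $p_n\in H_n$, i.e. $\Lambda f=\sum_{n\ge0}\lambda_nT_nf$. A constant $E$ as in the claim is known to exist (a Bernstein-type inequality). *)

theory Defs
  imports "HOL-Probability.Probability" "HOL-Library.Function_Algebras"
    "HOL-Computational_Algebra.Polynomial"
begin

text \<open>
  The unit sphere of dimension \<open>d\<close> is \<^term>\<open>sphere 0 1\<close> in \<open>real ^ 'n\<close> with \<open>CARD('n) = d + 1\<close>.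
\<close>

definition geodist :: "real ^ 'n \<Rightarrow> real ^ 'n \<Rightarrow> real" where
  "geodist x y = arccos (x \<bullet> y)"

definition fill_distance :: "(real ^ 'n) set \<Rightarrow> real" where
  "fill_distance Y = (SUP x\<in>sphere 0 1. Min (geodist x ` Y))"

text \<open>
  The measure lives on the sphere itself (it is the whole space of the measure), so values of
  functions off the sphere never matter for measurability or for integrals.
\<close>

definition rotation_invariant_prob :: "(real ^ 'n) measure \<Rightarrow> bool" where
  "rotation_invariant_prob \<nu> \<longleftrightarrow>
     space \<nu> = sphere 0 1 \<and> sets \<nu> = sets (restrict_space borel (sphere 0 1)) \<and>
     prob_space \<nu> \<and> (\<forall>A. rotation_matrix A \<longrightarrow> distr \<nu> \<nu> ((*v) A) = \<nu>)"

definition L2_space :: "'a measure \<Rightarrow> ('a \<Rightarrow> real) set" where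
  "L2_space \<nu> = {f \<in> borel_measurable \<nu>. integrable \<nu> (\<lambda>x. (f x)\<^sup>2)}"

definition L2_inner :: "'a measure \<Rightarrow> ('a \<Rightarrow> real) \<Rightarrow> ('a \<Rightarrow> real) \<Rightarrow> real" where
  "L2_inner \<nu> f g = (\<integral>x. f x * g x \<partial>\<nu>)"

definition L2_nrm :: "'a measure \<Rightarrow> ('a \<Rightarrow> real) \<Rightarrow> real" where
  "L2_nrm \<nu> f = sqrt (L2_inner \<nu> f f)"

definition Linf_nrm :: "'a measure \<Rightarrow> ('a \<Rightarrow> real) \<Rightarrow> real" where
  "Linf_nrm \<nu> f = real_of_ereal (esssup \<nu> (\<lambda>x. ereal \<bar>f x\<bar>))"

text \<open>
  Linear span and dimension in the vector space of real functions.
\<close>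

global_interpretation fun_vs: vector_space "\<lambda>(c::real) (f::'a \<Rightarrow> real) x. c * f x"
  by standard (auto simp: fun_eq_iff algebra_simps)

text \<open>
  A function on the sphere is represented by its extension by zero, so that equality of elements
  of the spaces below is equality on the sphere, and dimensions are those of the
  restricted polynomials.
\<close>

definition sphere_monomial :: "('n \<Rightarrow> nat) \<Rightarrow> real ^ 'n \<Rightarrow> real" where
  "sphere_monomial k = (\<lambda>x. if x \<in> sphere 0 1 then \<Prod>i\<in>UNIV. (x $ i) ^ k i else 0)"

definition sphere_polys :: "nat \<Rightarrow> (real ^ 'n \<Rightarrow> real) set" where
  "sphere_polys n = fun_vs.span {sphere_monomial k | k. (\<Sum>i\<in>UNIV. k i) \<le> n}"

text \<open>
  Quantifying over all \<open>m < n\<close> instead of taking \<open>m = n - 1\<close> covers the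
  convention that the polynomials of degree at most \<open>-1\<close> are zero.
\<close>

definition harmonics :: "(real ^ 'n) measure \<Rightarrow> nat \<Rightarrow> (real ^ 'n \<Rightarrow> real) set" where
  "harmonics \<nu> n =
     {p \<in> sphere_polys n. \<forall>m<n. \<forall>q\<in>sphere_polys m. L2_inner \<nu> p q = 0}"

definition harmonic_dim :: "(real ^ 'n) measure \<Rightarrow> nat \<Rightarrow> nat" where
  "harmonic_dim \<nu> n = fun_vs.dim (harmonics \<nu> n)"

definition harmonic_onb ::
  "(real ^ 'n) measure \<Rightarrow> nat \<Rightarrow> (nat \<Rightarrow> real ^ 'n \<Rightarrow> real) \<Rightarrow> bool" where
  "harmonic_onb \<nu> n B \<longleftrightarrow>
     (\<forall>i\<in>{1..harmonic_dim \<nu> n}. \<forall>j\<in>{1..harmonic_dim \<nu> n}.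
        L2_inner \<nu> (B i) (B j) = (if i = j then 1 else 0)) \<and>
     fun_vs.span (B ` {1..harmonic_dim \<nu> n}) = harmonics \<nu> n"

definition harmonic_proj ::
  "(real ^ 'n) measure \<Rightarrow> nat \<Rightarrow> (real ^ 'n \<Rightarrow> real) \<Rightarrow> real ^ 'n \<Rightarrow> real" where
  "harmonic_proj \<nu> n f =
     (THE g. g \<in> harmonics \<nu> n \<and> (\<forall>h\<in>harmonics \<nu> n. L2_inner \<nu> f h = L2_inner \<nu> g h))"

text \<open>
  Gegenbauer polynomials with parameter \<open>(d - 1) / 2\<close>, up to a nonzero factor, given by
  their orthogonality with respect to the weight \<open>(1 - t\<^sup>2) powr ((d - 2) / 2)\<close>.  Unlike the
  classical recurrence, this also makes sense for \<open>d = 1\<close> (Chebyshev polynomials).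
\<close>

definition gegenbauer :: "nat \<Rightarrow> nat \<Rightarrow> real poly \<Rightarrow> bool" where
  "gegenbauer d n p \<longleftrightarrow> p \<noteq> 0 \<and> degree p = n \<and>
     (\<forall>q. degree q < n \<longrightarrow>
        (LINT t:{-1..1}|lborel. poly p t * poly q t * (1 - t\<^sup>2) powr ((real d - 2) / 2)) = 0)"

definition normalised_gegenbauer ::
  "(real ^ 'n) measure \<Rightarrow> nat \<Rightarrow> (nat \<Rightarrow> real ^ 'n \<Rightarrow> real) \<Rightarrow> real poly \<Rightarrow> bool" where
  "normalised_gegenbauer \<nu> n B p \<longleftrightarrow> gegenbauer (CARD('n) - 1) n p \<and>
     (\<forall>x\<in>sphere 0 1. \<forall>y\<in>sphere 0 1.
        poly p (x \<bullet> y) = (\<Sum>j=1..harmonic_dim \<nu> n. B j x * B j y))"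

text \<open>
  Elements of the native space are identified with their continuous representatives, so
  continuity on the sphere is part of membership.
\<close>

definition native_space ::
  "(real ^ 'n) measure \<Rightarrow> (nat \<Rightarrow> real) \<Rightarrow> (real ^ 'n \<Rightarrow> real) set" where
  "native_space \<nu> a =
     {f \<in> L2_space \<nu>. continuous_on (sphere 0 1) f \<and>
        summable (\<lambda>n. inverse (a n) * (L2_nrm \<nu> (harmonic_proj \<nu> n f))\<^sup>2)}"

definition native_nrm ::
  "(real ^ 'n) measure \<Rightarrow> (nat \<Rightarrow> real) \<Rightarrow> (real ^ 'n \<Rightarrow> real) \<Rightarrow> real" where
  "native_nrm \<nu> a f =
     sqrt (\<Sum>n. inverse (a n) * (L2_nrm \<nu> (harmonic_proj \<nu> n f))\<^sup>2)"

definition spline_interpolant ::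
  "(real \<Rightarrow> real) \<Rightarrow> (real ^ 'n) set \<Rightarrow> (real ^ 'n \<Rightarrow> real) \<Rightarrow> (real ^ 'n \<Rightarrow> real) \<Rightarrow> bool" where
  "spline_interpolant \<phi> Y f S \<longleftrightarrow>
     (\<exists>\<alpha>. \<forall>x\<in>sphere 0 1. S x = (\<Sum>y\<in>Y. \<alpha> y * \<phi> (geodist x y))) \<and>
     (\<forall>y\<in>Y. S y = f y)"

text \<open>
  The series is taken pointwise on the sphere; where it converges uniformly its sum is the
  continuous representative of the corresponding series in the space of square-integrable functions.
\<close>

definition pseudodiff ::
  "(real ^ 'n) measure \<Rightarrow> (nat \<Rightarrow> real) \<Rightarrow> (real ^ 'n \<Rightarrow> real) \<Rightarrow> real ^ 'n \<Rightarrow> real" where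
  "pseudodiff \<nu> lam f x = (\<Sum>n. lam n * harmonic_proj \<nu> n f x)"

end

theory Submission
  imports Defs
begin

text \<open>
  Write \<open>v = f - S\<close>, a continuous function vanishing on \<open>Y\<close>, and split its harmonic expansion at
  degree \<open>N\<close> into a polynomial \<open>p\<close> and a tail.  On \<open>Y\<close> the polynomial is minus the tail.  By
  Bernstein's inequality along great circles, \<open>Y\<close> is fine enough that the maximum of \<open>\<bar>p\<bar>\<close> on the
  sphere is at most twice its maximum on \<open>Y\<close>.  Hence the assumed bound on \<open>\<Lambda> p\<close> controls
  \<open>\<Lambda> p\<close> by \<open>2 E \<lambda>\<^sub>N\<close> times the tail, and \<open>\<lambda>\<close> is monotone, so both parts of \<open>\<Lambda> v\<close> are
  bounded by the sum of \<open>\<lambda>\<^sub>n \<parallel>T\<^sub>n v\<parallel> sqrt d\<^sub>n\<close> over \<open>n \<ge> N\<close>, to which the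
  Cauchy--Schwarz inequality applies.
\<close>

section \<open>Bernstein's inequality for trigonometric polynomials\<close>

text \<open>The factor 2 is the price of the fill distance: along a great circle a polynomial of
  degree \<open>N\<close> changes by at most \<open>N\<close> times its maximum per unit of arc, so
  a step of length 1/(2N) away from a maximum point keeps half of the maximum. A larger constant in
  Bernstein's inequality would spoil this factor. The other obstacle is that the argument is
  pointwise while its data live in L2: values of \<open>v\<close> at points of \<open>Y\<close> are
  used and the operator is a pointwise series, yet the assumed bound is in the essential supremum
  norm. Two facts bridge the gap for continuous functions: the invariant measure charges every
  nonempty relatively open part of the sphere, and a continuous function whose harmonic coefficients
  all vanish is zero, by Stone-Weierstrass. The dimension \<open>d\<^sub>n\<close> enters through
  the diagonal of the kernel: the squares of an orthonormal basis of degree \<open>n\<close> sum to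
  \<open>d\<^sub>n\<close> at every point, which converts L2 norms into sup norms.\<close>

text \<open>
  M. Riesz's interpolation formula: for a trigonometric polynomial \<open>T\<close> of degree at most \<open>n\<close>,
  \<open>T'(t)\<close> is half the sum of \<open>(- 1) ^ j * fejer n t\<^sub>j * T (t + t\<^sub>j)\<close> over the \<open>2 n\<close>
  nodes \<open>t\<^sub>j\<close>.  The Fejer weights are nonnegative with sum \<open>2 n\<close>, whence the sharp constant.
\<close>

definition riesz_node :: "nat \<Rightarrow> nat \<Rightarrow> real" where
  "riesz_node n j = (2 * real j + 1) * pi / (2 * real n)"

text \<open>Written as a squared modulus, the Fejer kernel is visibly nonnegative; computations use
  its expansion into a double sum of exponentials.\<close>

definition fejer :: "nat \<Rightarrow> real \<Rightarrow> real" where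
  "fejer n t = (cmod (\<Sum>k<n. cis (real k * t)))\<^sup>2 / real n"

lemma fejer_nonneg: "0 \<le> fejer n t"
  by (simp add: fejer_def)

lemma fejer_eq:
  "of_real (fejer n t) = (\<Sum>a<n. \<Sum>b<n. cis (of_int (int a - int b) * t)) / of_nat n"
proof -
  have "of_real ((cmod (\<Sum>k<n. cis (real k * t)))\<^sup>2)
      = (\<Sum>a<n. cis (real a * t)) * cnj (\<Sum>b<n. cis (real b * t))"
    by (rule complex_norm_square)
  also have "\<dots> = (\<Sum>a<n. \<Sum>b<n. cis (of_int (int a - int b) * t))"
    by (simp add: sum_product cis_cnj cis_mult algebra_simps)
  finally show ?thesis
    by (simp add: fejer_def)
qed

text \<open>The sum is geometric with ratio \<open>cis (m * pi / n)\<close>, so it vanishes unless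
  2n divides \<open>m\<close>; the half-step offset of the nodes gives the sign (-1)^k at m = 2nk.
  The bound on \<open>m\<close> leaves only k in {-1, 0, 1} and covers every frequency met
  below.\<close>

lemma sum_cis_riesz_node:
  fixes m :: int
  assumes n: "n > 0" and m: "\<bar>m\<bar> < 4 * int n"
  shows "(\<Sum>j<2 * n. cis (of_int m * riesz_node n j))
       = of_nat (2 * n) * (of_bool (m = 0) - of_bool (\<bar>m\<bar> = 2 * int n))"
proof -
  define z where "z = cis (of_int m * pi / real n)"
  have *: "cis (of_int m * riesz_node n j) = cis (of_int m * pi / (2 * real n)) * z ^ j" for j
    using n by (simp add: z_def Complex.DeMoivre cis_mult riesz_node_def field_simps)
  have S: "(\<Sum>j<2 * n. cis (of_int m * riesz_node n j))
      = cis (of_int m * pi / (2 * real n)) * (\<Sum>j<2 * n. z ^ j)"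
    by (simp add: * sum_distrib_left)
  show ?thesis
  proof (cases "z = 1")
    case False
    have "z ^ (2 * n) = cis (of_int m * (2 * pi))"
      using n by (simp add: z_def Complex.DeMoivre field_simps)
    also have "\<dots> = 1"
      by (metis Ints_of_int cis_multiple_2pi mult.commute)
    finally have "(\<Sum>j<2 * n. z ^ j) = 0"
      using False by (simp add: sum_gp_strict)
    moreover have "m \<noteq> 0" "\<bar>m\<bar> \<noteq> 2 * int n"
    proof -
      show "m \<noteq> 0" using False by (auto simp: z_def)
      show "\<bar>m\<bar> \<noteq> 2 * int n"
      proof
        assume "\<bar>m\<bar> = 2 * int n"
        then have "m = 2 * int n \<or> m = - (2 * int n)" by linarith
        then show False using False n by (auto simp: z_def complex_eq_iff)
      qed
    qed
    ultimately show ?thesis by (simp add: S)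
  next
    case True
    then obtain k :: int where k: "of_int m * pi / real n = of_int k * (2 * pi)"
      unfolding z_def by (auto simp: complex_eq_iff cos_one_2pi_int)
    then have "real_of_int m = of_int (2 * k * int n)"
      using n by (simp add: field_simps)
    then have mk: "m = 2 * k * int n" by linarith
    then have "\<bar>k\<bar> * (2 * int n) < 2 * (2 * int n)"
      using m by (simp add: abs_mult)
    then have "\<bar>k\<bar> < 2" using n by (simp add: mult_less_cancel_right)
    then have k01: "k = 0 \<or> k = 1 \<or> k = -1" by linarith
    have "cis (of_int m * pi / (2 * real n)) = cis (of_int k * pi)"
      using n by (simp add: mk field_simps)
    then have "(\<Sum>j<2 * n. cis (of_int m * riesz_node n j)) = of_nat (2 * n) * cis (of_int k * pi)"
      by (simp add: S True)
    also have "cis (of_int k * pi) = of_bool (m = 0) - of_bool (\<bar>m\<bar> = 2 * int n)"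
      using k01 n by (auto simp: mk complex_eq_iff)
    finally show ?thesis .
  qed
qed

text \<open>The condition \<open>b < n\<close> forces \<open>a < - l\<close>, and then
  \<open>a\<close> determines \<open>b\<close>, so the count is the negative part of
  \<open>l\<close>. Applied to \<open>- l\<close> it gives the positive part.\<close>

lemma count_shifted_pairs:
  fixes l :: int
  assumes "\<bar>l\<bar> \<le> int n"
  shows "(\<Sum>a<n. \<Sum>b<n. of_bool (int b = int n + int a + l)) = (of_nat (nat (- l)) :: complex)"
proof -
  have "(\<Sum>b<n. of_bool (int b = int n + int a + l)) = (of_bool (a < nat (- l)) :: complex)" for a
  proof -
    have "(int b = int n + int a + l) = (b = nat (int n + int a + l))" for b
      using assms by auto
    then have "(\<Sum>b<n. of_bool (int b = int n + int a + l))
        = (\<Sum>b<n. if b = nat (int n + int a + l) then 1 else (0::complex))"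
      by (intro sum.cong) auto
    also have "\<dots> = of_bool (a < nat (- l))"
      using assms by (auto simp: sum.delta)
    finally show ?thesis .
  qed
  then have "(\<Sum>a<n. \<Sum>b<n. of_bool (int b = int n + int a + l))
      = (\<Sum>a<n. of_bool (a < nat (- l)) :: complex)" by simp
  also have "\<dots> = of_nat (card ({..<n} \<inter> {a. a < nat (- l)}))"
    by (simp add: Int_def)
  also have "{..<n} \<inter> {a. a < nat (- l)} = {..<nat (- l)}"
    using assms by auto
  finally show ?thesis by simp
qed

text \<open>Of the frequencies n + a - b + l, only those equal to 0 and to 2n survive the summation
  over the nodes, with opposite signs. Their numbers differ by exactly \<open>l\<close>, which up to
  \<i> is the factor that differentiation puts on \<open>cis (l * t)\<close>.\<close>

lemma riesz_interpolation_cis: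
  fixes l :: int
  assumes n: "n > 0" and l: "\<bar>l\<bar> \<le> int n"
  shows "(\<Sum>j<2 * n. (- 1) ^ j * of_real (fejer n (riesz_node n j)) * cis (of_int l * riesz_node n j))
       = 2 * \<i> * of_int l"
proof -
  let ?t = "riesz_node n"
  \<comment> \<open>The nodes are zeros of cos (n t), where \<open>cis (n * t)\<close> is \<i> times
    the alternating sign. Replacing the sign by a character makes every factor an
    exponential.\<close>
  have sgn: "(- 1) ^ j = - \<i> * cis (of_int (int n) * ?t j)" for j
  proof -
    have "of_int (int n) * ?t j = pi / 2 + real j * pi"
      using n by (simp add: riesz_node_def field_simps)
    then have "cis (of_int (int n) * ?t j) = \<i> * (cis pi) ^ j"
      by (simp only: Complex.DeMoivre cis_pi_half[symmetric] cis_mult)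
    then show ?thesis by simp
  qed
  have "(- 1) ^ j * of_real (fejer n (?t j)) * cis (of_int l * ?t j)
      = - \<i> / of_nat n * (\<Sum>a<n. \<Sum>b<n. cis (of_int (int n + int a - int b + l) * ?t j))" for j
    unfolding sgn fejer_eq
    by (simp add: sum_distrib_left sum_distrib_right sum_divide_distrib cis_mult algebra_simps)
  then have "(\<Sum>j<2 * n. (- 1) ^ j * of_real (fejer n (?t j)) * cis (of_int l * ?t j))
      = - \<i> / of_nat n *
        (\<Sum>j<2 * n. \<Sum>a<n. \<Sum>b<n. cis (of_int (int n + int a - int b + l) * ?t j))"
    by (simp add: sum_distrib_left)
  also have "(\<Sum>j<2 * n. \<Sum>a<n. \<Sum>b<n. cis (of_int (int n + int a - int b + l) * ?t j))
      = (\<Sum>a<n. \<Sum>b<n. \<Sum>j<2 * n. cis (of_int (int n + int a - int b + l) * ?t j))"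
    by (subst sum.swap, rule sum.cong[OF refl], rule sum.swap)
  \<comment> \<open>The frequencies lie between 1 - n and 3n - 1, so of the two values with modulus
    2n only 2n itself occurs.\<close>
  also have "\<dots> = (\<Sum>a<n. \<Sum>b<n. of_nat (2 * n) *
        (of_bool (int b = int n + int a + l) - of_bool (int a = int n + int b + (- l))))"
    using n l by (intro sum.cong refl, subst sum_cis_riesz_node) auto
  also have "\<dots> = of_nat (2 * n) *
      ((\<Sum>a<n. \<Sum>b<n. of_bool (int b = int n + int a + l))
       - (\<Sum>b<n. \<Sum>a<n. of_bool (int a = int n + int b + (- l))))"
    by (subst (3) sum.swap) (simp only: sum_distrib_left sum_subtractf right_diff_distrib)
  also have "\<dots> = of_nat (2 * n) * (of_nat (nat (- l)) - of_nat (nat l))"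
    using l by (subst count_shifted_pairs, simp, subst count_shifted_pairs) auto
  also have "(of_nat (nat (- l)) - of_nat (nat l) :: complex) = - of_int l"
    by (cases "l \<ge> 0") auto
  finally show ?thesis using n by simp
qed

text \<open>All frequencies \<open>a - b\<close> are below \<open>n\<close> in modulus, so only the
  diagonal terms survive. Half of this total is the constant \<open>n\<close> in Bernstein's
  inequality.\<close>

lemma sum_fejer_riesz_node:
  assumes n: "n > 0"
  shows "(\<Sum>j<2 * n. fejer n (riesz_node n j)) = 2 * real n"
proof -
  have "complex_of_real (\<Sum>j<2 * n. fejer n (riesz_node n j))
     = (\<Sum>j<2 * n. \<Sum>a<n. \<Sum>b<n. cis (of_int (int a - int b) * riesz_node n j)) / of_nat n"
    by (simp only: of_real_sum fejer_eq sum_divide_distrib)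
  also have "(\<Sum>j<2 * n. \<Sum>a<n. \<Sum>b<n. cis (of_int (int a - int b) * riesz_node n j))
     = (\<Sum>a<n. \<Sum>b<n. \<Sum>j<2 * n. cis (of_int (int a - int b) * riesz_node n j))"
    by (subst sum.swap, rule sum.cong[OF refl], rule sum.swap)
  also have "\<dots> = (\<Sum>a<n. \<Sum>b<n. if b = a then of_nat (2 * n) else 0)"
    using n by (intro sum.cong refl, subst sum_cis_riesz_node) auto
  also have "\<dots> / of_nat n = complex_of_real (2 * real n)"
    using n by (simp add: sum.delta)
  finally show ?thesis using of_real_eq_iff by blast
qed

text \<open>Multiplication by \<open>cis (n * t)\<close> turns a Laurent polynomial in
  \<open>cis t\<close> with frequencies from -n to n into an ordinary polynomial, so closure
  properties reduce to degree bounds for \<open>poly\<close>.\<close>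

definition trig_poly :: "nat \<Rightarrow> (real \<Rightarrow> complex) \<Rightarrow> bool" where
  "trig_poly n T \<longleftrightarrow> (\<exists>q. degree q \<le> 2 * n \<and> (\<forall>t. cis (real n * t) * T t = poly q (cis t)))"

lemma trig_polyD:
  assumes "trig_poly n T"
  obtains b where "\<And>t. T t = (\<Sum>k\<le>2 * n. b k * cis (of_int (int k - int n) * t))"
proof -
  obtain q where q: "degree q \<le> 2 * n" "\<And>t. cis (real n * t) * T t = poly q (cis t)"
    using assms by (auto simp: trig_poly_def)
  have "T t = (\<Sum>k\<le>2 * n. coeff q k * cis (of_int (int k - int n) * t))" for t
  proof -
    have "T t = cis (- (real n * t)) * (cis (real n * t) * T t)"
      by (simp add: cis_mult flip: mult.assoc)
    also have "\<dots> = cis (- (real n * t)) * (\<Sum>k\<le>2 * n. coeff q k * cis t ^ k)"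
      unfolding q(2) poly_altdef using q(1)
      by (intro arg_cong2[where f = times] refl sum.mono_neutral_left) (auto simp: coeff_eq_0)
    also have "\<dots> = (\<Sum>k\<le>2 * n. coeff q k * cis (of_int (int k - int n) * t))"
      by (simp add: sum_distrib_left Complex.DeMoivre cis_mult algebra_simps)
    finally show ?thesis .
  qed
  then show ?thesis by (rule that)
qed

text \<open>Both sides are linear in \<open>T\<close>, and on a single exponential the shift by a
  node splits off as a factor, which leaves \<open>riesz_interpolation_cis\<close>.\<close>

lemma riesz_interpolation:
  assumes n: "n > 0" and T: "trig_poly n T"
  shows "(T has_vector_derivative
    (\<Sum>j<2 * n. (- 1) ^ j * of_real (fejer n (riesz_node n j)) * T (t + riesz_node n j)) / 2) (at t)"
proof -
  let ?c = "\<lambda>j. (- 1) ^ j * complex_of_real (fejer n (riesz_node n j))"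
  obtain b where b: "\<And>t. T t = (\<Sum>k\<le>2 * n. b k * cis (of_int (int k - int n) * t))"
    using trig_polyD[OF T] by blast
  have "(\<Sum>j<2 * n. ?c j * T (t + riesz_node n j))
      = (\<Sum>k\<le>2 * n. b k * cis (of_int (int k - int n) * t) *
           (\<Sum>j<2 * n. ?c j * cis (of_int (int k - int n) * riesz_node n j)))"
    unfolding b sum_distrib_left
    by (subst sum.swap, intro sum.cong refl) (simp add: distrib_left flip: cis_mult)
  also have "\<dots> = (\<Sum>k\<le>2 * n. b k * cis (of_int (int k - int n) * t) * (2 * \<i> * of_int (int k - int n)))"
    using n by (intro sum.cong refl, subst riesz_interpolation_cis) auto
  also have "\<dots> = 2 * (\<Sum>k\<le>2 * n. b k * (of_int (int k - int n) * (\<i> * cis (of_int (int k - int n) * t))))"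
    by (simp only: sum_distrib_left mult_ac)
  finally have eq: "(\<Sum>j<2 * n. ?c j * T (t + riesz_node n j)) / 2
      = (\<Sum>k\<le>2 * n. b k * (of_int (int k - int n) * (\<i> * cis (of_int (int k - int n) * t))))"
    by simp
  have "((\<lambda>t. cis (r * t)) has_vector_derivative (r *\<^sub>R (\<i> * cis (r * t)))) (at t)" for r
    unfolding cis_conv_exp of_real_mult
    by (rule has_vector_derivative_real_field)
      (auto intro!: derivative_eq_intros simp: scaleR_conv_of_real)
  then have "((\<lambda>t. \<Sum>k\<le>2 * n. b k * cis (of_int (int k - int n) * t)) has_vector_derivative
      (\<Sum>k\<le>2 * n. b k * (of_int (int k - int n) *\<^sub>R (\<i> * cis (of_int (int k - int n) * t))))) (at t)"
    by (intro has_vector_derivative_sum has_vector_derivative_mult_right)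
  then show ?thesis
    unfolding eq using b[abs_def] by (simp add: scaleR_conv_of_real)
qed

theorem bernstein_inequality:
  fixes T :: "real \<Rightarrow> real"
  assumes T: "trig_poly n (\<lambda>t. of_real (T t))" and M: "\<And>t. \<bar>T t\<bar> \<le> M"
  obtains T' where "\<And>t. (T has_real_derivative T' t) (at t)" "\<And>t. \<bar>T' t\<bar> \<le> real n * M"
\<comment> \<open>For \<open>n = 0\<close> there are no nodes to sum over, but then \<open>T\<close>
  is constant.\<close>
proof (cases "n = 0")
  case True
  then obtain q where "degree q \<le> 0" "\<And>t. of_real (T t) = poly q (cis t)"
    using T by (auto simp: trig_poly_def)
  then obtain c where "\<And>t. complex_of_real (T t) = c"
    by (auto elim!: degree_eq_zeroE)
  then have "T = (\<lambda>_. T 0)" by (metis of_real_eq_iff ext)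
  then have "(T has_real_derivative 0) (at t)" for t by (metis DERIV_const)
  then show ?thesis using that[of "\<lambda>_. 0"] True by simp
next
  case False
  then have n: "n > 0" by simp
  let ?F = "\<lambda>j. fejer n (riesz_node n j)"
  define T' where "T' t = (\<Sum>j<2 * n. (- 1) ^ j * ?F j * T (t + riesz_node n j)) / 2" for t
  show ?thesis
  proof
    fix t
    have "((\<lambda>t. complex_of_real (T t)) has_vector_derivative of_real (T' t)) (at t)"
      using riesz_interpolation[OF n T, of t] by (simp add: T'_def)
    then have "((\<lambda>t. Re (of_real (T t))) has_vector_derivative Re (of_real (T' t))) (at t)"
      by (rule bounded_linear.has_vector_derivative[OF bounded_linear_Re])
    then show "(T has_real_derivative T' t) (at t)"
      by (simp add: has_real_derivative_iff_has_vector_derivative)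
    have "\<bar>\<Sum>j<2 * n. (- 1) ^ j * ?F j * T (t + riesz_node n j)\<bar> \<le> (\<Sum>j<2 * n. ?F j * M)"
      by (rule order_trans[OF sum_abs sum_mono])
        (simp add: abs_mult power_abs fejer_nonneg M mult_left_mono)
    also have "\<dots> = 2 * real n * M"
      by (simp add: sum_fejer_riesz_node[OF n] flip: sum_distrib_right)
    finally show "\<bar>T' t\<bar> \<le> real n * M" by (simp add: T'_def)
  qed
qed

section \<open>Closure properties of trigonometric polynomials\<close>

lemma trig_poly_mult:
  assumes "trig_poly m S" "trig_poly n T"
  shows "trig_poly (m + n) (\<lambda>t. S t * T t)"
proof -
  obtain p q where p: "degree p \<le> 2 * m" "\<And>t. cis (real m * t) * S t = poly p (cis t)"
    and q: "degree q \<le> 2 * n" "\<And>t. cis (real n * t) * T t = poly q (cis t)"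
    using assms by (auto simp: trig_poly_def)
  have "degree (p * q) \<le> 2 * (m + n)"
    using degree_mult_le[of p q] p(1) q(1) by simp
  moreover have "cis (real (m + n) * t) * (S t * T t) = poly (p * q) (cis t)" for t
    by (simp add: p(2)[symmetric] q(2)[symmetric] distrib_right flip: cis_mult)
  ultimately show ?thesis unfolding trig_poly_def by blast
qed

lemma trig_poly_const: "trig_poly n (\<lambda>_. c)"
  unfolding trig_poly_def
  by (rule exI[of _ "monom c n"])
    (auto simp: poly_monom Complex.DeMoivre intro: order_trans[OF degree_monom_le])

lemma trig_poly_mono:
  assumes "trig_poly m T" "m \<le> n"
  shows "trig_poly n T"
  using trig_poly_mult[OF assms(1) trig_poly_const[of "n - m" 1]] assms(2) by simp

lemma trig_poly_add:
  assumes "trig_poly n S" "trig_poly n T"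
  shows "trig_poly n (\<lambda>t. S t + T t)"
proof -
  obtain p q where p: "degree p \<le> 2 * n" "\<And>t. cis (real n * t) * S t = poly p (cis t)"
    and q: "degree q \<le> 2 * n" "\<And>t. cis (real n * t) * T t = poly q (cis t)"
    using assms by (auto simp: trig_poly_def)
  have "degree (p + q) \<le> 2 * n"
    using degree_add_le p(1) q(1) by blast
  moreover have "cis (real n * t) * (S t + T t) = poly (p + q) (cis t)" for t
    by (simp add: p(2)[symmetric] q(2)[symmetric] distrib_left)
  ultimately show ?thesis unfolding trig_poly_def by blast
qed

lemma trig_poly_scale: "trig_poly n T \<Longrightarrow> trig_poly n (\<lambda>t. c * T t)"
  using trig_poly_mult[OF trig_poly_const[of 0 c]] by simp

lemma trig_poly_cos_sin: "trig_poly 1 (\<lambda>t. of_real (a * cos t + b * sin t))"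
proof -
  \<comment> \<open>Euler's formulas: a cos t + b sin t is (a + \<i> b)/2 times
    \<open>cis (- t)\<close> plus (a - \<i> b)/2 times \<open>cis t\<close>.\<close>
  let ?q = "[:Complex (a / 2) (b / 2), 0, Complex (a / 2) (- (b / 2)):]"
  have "cis (real 1 * t) * of_real (a * cos t + b * sin t) = poly ?q (cis t)" for t
  proof -
    have c: "(cos t)\<^sup>2 = 1 - (sin t)\<^sup>2" by (simp add: cos_squared_eq)
    show ?thesis
      by (simp add: complex_eq_iff field_simps power2_eq_square[symmetric] c)
  qed
  then show ?thesis unfolding trig_poly_def by (intro exI[of _ ?q]) simp
qed

lemma trig_poly_power: "trig_poly m T \<Longrightarrow> trig_poly (k * m) (\<lambda>t. T t ^ k)"
  by (induction k) (auto intro: trig_poly_const trig_poly_mult)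

lemma trig_poly_prod:
  fixes k :: "'i \<Rightarrow> nat"
  assumes "finite I" "\<And>i. i \<in> I \<Longrightarrow> trig_poly (k i) (T i)"
  shows "trig_poly (sum k I) (\<lambda>t. \<Prod>i\<in>I. T i t)"
  using assms by (induction I) (auto intro: trig_poly_const trig_poly_mult)

section \<open>Polynomials on the sphere\<close>

lemma subspace_continuous_on:
  "fun_vs.subspace {p. continuous_on S (p :: 'a::topological_space \<Rightarrow> real)}"
  by (auto simp: fun_vs.subspace_def plus_fun_def zero_fun_def intro!: continuous_intros)

lemma sphere_polys_continuous:
  assumes "p \<in> sphere_polys n"
  shows "continuous_on (sphere 0 1) p"
proof -
  have "continuous_on (sphere 0 1) (sphere_monomial k :: real ^ 'n \<Rightarrow> real)" for k
    by (rule continuous_on_cong[THEN iffD1, OF refl, of _ "\<lambda>x. \<Prod>i\<in>UNIV. (x $ i) ^ k i"])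
      (auto simp: sphere_monomial_def intro!: continuous_intros)
  then have "{sphere_monomial k | k. (\<Sum>i\<in>UNIV. k i) \<le> n}
      \<subseteq> {p. continuous_on (sphere 0 1) (p :: real ^ 'n \<Rightarrow> real)}"
    by auto
  then show ?thesis
    using assms fun_vs.span_minimal[OF _ subspace_continuous_on] unfolding sphere_polys_def by blast
qed

section \<open>Great circles and norming sets\<close>

lemma great_circle_norm:
  assumes "norm x = 1" "norm u = 1" "x \<bullet> u = 0"
  shows "norm (cos t *\<^sub>R x + sin t *\<^sub>R u) = 1"
proof -
  have "(norm (cos t *\<^sub>R x + sin t *\<^sub>R u))\<^sup>2 = (norm (cos t *\<^sub>R x))\<^sup>2 + (norm (sin t *\<^sub>R u))\<^sup>2"
    using assms by (intro norm_add_Pythagorean) (simp add: orthogonal_def)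
  also have "\<dots> = 1"
    using assms by simp
  finally show ?thesis by (simp add: abs_square_eq_1)
qed

text \<open>On a great circle each coordinate is a trigonometric polynomial of degree 1, so
  monomials keep their degree; the property defines a subspace and hence passes to the span.\<close>

lemma sphere_polys_great_circle:
  assumes p: "p \<in> sphere_polys n" and x: "norm x = 1" and u: "norm u = 1" and xu: "x \<bullet> u = 0"
  shows "trig_poly n (\<lambda>t. of_real (p (cos t *\<^sub>R x + sin t *\<^sub>R u)))"
proof -
  let ?G = "{p. trig_poly n (\<lambda>t. of_real (p (cos t *\<^sub>R x + sin t *\<^sub>R u)))}"
  have "fun_vs.subspace ?G"
    by (auto simp: fun_vs.subspace_def plus_fun_def zero_fun_def
        intro: trig_poly_add trig_poly_scale trig_poly_const)
  moreover have "{sphere_monomial k | k. (\<Sum>i\<in>UNIV. k i) \<le> n} \<subseteq> ?G"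
  proof clarify
    fix k :: "'a \<Rightarrow> nat" assume k: "(\<Sum>i\<in>UNIV. k i) \<le> n"
    have "norm (cos t *\<^sub>R x + sin t *\<^sub>R u) = 1" for t
      using great_circle_norm x u xu .
    then have "complex_of_real (sphere_monomial k (cos t *\<^sub>R x + sin t *\<^sub>R u))
        = (\<Prod>i\<in>UNIV. of_real (x $ i * cos t + u $ i * sin t) ^ k i)" for t
      by (simp add: sphere_monomial_def mult.commute)
    moreover have "trig_poly (\<Sum>i\<in>UNIV. k i)
        (\<lambda>t. \<Prod>i\<in>UNIV. of_real (x $ i * cos t + u $ i * sin t) ^ k i)"
    proof (rule trig_poly_prod)
      fix i
      show "trig_poly (k i) (\<lambda>t. of_real (x $ i * cos t + u $ i * sin t) ^ k i)"
        using trig_poly_power[OF trig_poly_cos_sin, of "k i" "x $ i" "u $ i"] by simp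
    qed simp
    ultimately show "trig_poly n
        (\<lambda>t. of_real (sphere_monomial k (cos t *\<^sub>R x + sin t *\<^sub>R u)))"
      using k trig_poly_mono by presburger
  qed
  ultimately show ?thesis
    using p fun_vs.span_minimal unfolding sphere_polys_def by blast
qed

text \<open>\<open>u\<close> is the Gram-Schmidt direction of \<open>y\<close> against
  \<open>x\<close>. Normalising it divides by the sine of the angle, which vanishes exactly for
  equal and antipodal points.\<close>

lemma sphere_great_circle:
  assumes x: "norm x = 1" and y: "norm y = 1" and xy: "geodist x y < pi" "x \<noteq> y"
  obtains u where "norm u = 1" "x \<bullet> u = 0"
    "y = cos (geodist x y) *\<^sub>R x + sin (geodist x y) *\<^sub>R u"
proof -
  define \<theta> where "\<theta> = geodist x y"
  have ip: "-1 \<le> x \<bullet> y" "x \<bullet> y \<le> 1"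
    using Cauchy_Schwarz_ineq2[of x y] x y by auto
  then have c: "cos \<theta> = x \<bullet> y" by (simp add: \<theta>_def geodist_def)
  have "x \<bullet> y \<noteq> 1"
  proof
    assume "x \<bullet> y = 1"
    then have "(x - y) \<bullet> (x - y) = 0"
      using x y by (simp add: inner_diff inner_commute[of y x] norm_eq_1)
    then show False using xy by simp
  qed
  then have "\<theta> \<noteq> 0" using c by auto
  moreover have "0 \<le> \<theta>" using ip by (simp add: \<theta>_def geodist_def arccos_lbound)
  ultimately have "0 < \<theta>" "\<theta> < pi" using xy by (simp_all add: \<theta>_def)
  then have s: "sin \<theta> > 0" by (rule sin_gt_zero)
  define u where "u = (1 / sin \<theta>) *\<^sub>R (y - cos \<theta> *\<^sub>R x)"
  have "(y - cos \<theta> *\<^sub>R x) \<bullet> (y - cos \<theta> *\<^sub>R x) = 1 - (cos \<theta>)\<^sup>2"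
    using x y c by (simp add: inner_diff inner_commute[of y x] norm_eq_1 power2_eq_square algebra_simps)
  then have "(norm (y - cos \<theta> *\<^sub>R x))\<^sup>2 = (sin \<theta>)\<^sup>2"
    by (simp add: power2_norm_eq_inner sin_squared_eq)
  then have "norm u = 1"
    using s by (simp add: u_def power2_eq_iff_nonneg)
  moreover have "x \<bullet> u = 0"
    using x c by (simp add: u_def inner_diff norm_eq_1)
  moreover have "y = cos \<theta> *\<^sub>R x + sin \<theta> *\<^sub>R u"
    using s by (simp add: u_def)
  ultimately show ?thesis using that by (simp add: \<theta>_def)
qed

text \<open>The great circle through \<open>x\<close> and \<open>y\<close> is parametrised by arc
  length, so the parameter difference is the geodesic distance. The bound \<open>M\<close> is asked
  for on the whole sphere because Bernstein's inequality is not local: a derivative is controlled by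
  values all around the circle.\<close>

lemma sphere_polys_lipschitz:
  fixes p :: "real ^ 'n \<Rightarrow> real"
  assumes p: "p \<in> sphere_polys n" and M: "\<And>x. x \<in> sphere 0 1 \<Longrightarrow> \<bar>p x\<bar> \<le> M"
    and x: "x \<in> sphere 0 1" and y: "y \<in> sphere 0 1" and xy: "geodist x y < pi"
  shows "\<bar>p y - p x\<bar> \<le> real n * M * geodist x y"
proof (cases "x = y")
  case True
  then show ?thesis using x by (simp add: geodist_def norm_eq_1)
next
  case False
  define \<theta> where "\<theta> = geodist x y"
  obtain u where u: "norm u = 1" "x \<bullet> u = 0" "y = cos \<theta> *\<^sub>R x + sin \<theta> *\<^sub>R u"
    using sphere_great_circle[of x y] x y xy False by (auto simp: \<theta>_def)
  define T where "T t = p (cos t *\<^sub>R x + sin t *\<^sub>R u)" for t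
  have "cos t *\<^sub>R x + sin t *\<^sub>R u \<in> sphere 0 1" for t
    using great_circle_norm[of x u] x u by simp
  then have "\<bar>T t\<bar> \<le> M" for t
    by (simp only: T_def M)
  moreover have "trig_poly n (\<lambda>t. of_real (T t))"
    unfolding T_def using sphere_polys_great_circle[OF p] x u by simp
  ultimately obtain T' where T': "\<And>t. (T has_real_derivative T' t) (at t)"
    "\<And>t. \<bar>T' t\<bar> \<le> real n * M"
    using bernstein_inequality by blast
  have "norm (T \<theta> - T 0) \<le> (real n * M) * norm (\<theta> - 0)"
    by (rule field_differentiable_bound[of UNIV T T']) (use T' in auto)
  moreover have "\<theta> \<ge> 0"
    using Cauchy_Schwarz_ineq2[of x y] x y by (auto simp: \<theta>_def geodist_def intro!: arccos_lbound)
  moreover have "T \<theta> = p y" "T 0 = p x"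
    by (simp_all add: T_def flip: u(3))
  ultimately show ?thesis
    by (simp add: \<theta>_def)
qed

text \<open>A supremum of reals dominates its members only once the family is known to be bounded;
  here the diameter \<open>pi\<close> of the sphere bounds it.\<close>

lemma fill_distance_witness:
  assumes Y: "finite Y" "Y \<noteq> {}" "Y \<subseteq> sphere 0 1" and x: "x \<in> sphere 0 1"
  obtains y where "y \<in> Y" "geodist x y \<le> fill_distance Y"
proof -
  have Min: "Min (geodist x ` Y) \<in> geodist x ` Y" for x
    using Y by (intro Min_in) auto
  have "geodist x y \<le> pi" if "x \<in> sphere 0 1" "y \<in> Y" for x y
    using Cauchy_Schwarz_ineq2[of x y] Y that by (auto simp: geodist_def intro!: arccos_ubound)
  then have "bdd_above ((\<lambda>x. Min (geodist x ` Y)) ` sphere 0 1)"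
    using Min by (intro bdd_aboveI2[of _ _ pi]) (metis imageE)
  then have "Min (geodist x ` Y) \<le> fill_distance Y"
    unfolding fill_distance_def using x by (intro cSUP_upper)
  then show ?thesis using Min[of x] that by (metis imageE)
qed

text \<open>The Lipschitz constant is proportional to the unknown maximum, so starting from a
  maximum point absorbs it: the value at the nearest point of \<open>Y\<close> differs by at most
  half of the maximum.\<close>

lemma sphere_polys_norming_set:
  fixes Y :: "(real ^ 'n) set"
  assumes n: "n > 0" and p: "p \<in> sphere_polys n"
    and Y: "finite Y" "Y \<noteq> {}" "Y \<subseteq> sphere 0 1"
    and fill: "fill_distance Y \<le> 1 / (2 * real n)"
    and m: "\<And>y. y \<in> Y \<Longrightarrow> \<bar>p y\<bar> \<le> m" and x: "x \<in> sphere 0 1"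
  shows "\<bar>p x\<bar> \<le> 2 * m"
proof -
  have "continuous_on (sphere 0 1) (\<lambda>x. \<bar>p x\<bar>)"
    using sphere_polys_continuous[OF p] by (intro continuous_intros)
  then obtain x0 where x0: "x0 \<in> sphere 0 1" "\<And>z. z \<in> sphere 0 1 \<Longrightarrow> \<bar>p z\<bar> \<le> \<bar>p x0\<bar>"
    using continuous_attains_sup[OF compact_sphere, of 0 1 "\<lambda>x. \<bar>p x\<bar>"] x by blast
  obtain y where y: "y \<in> Y" "geodist x0 y \<le> 1 / (2 * real n)"
    using fill_distance_witness[OF Y x0(1)] fill by (metis order_trans)
  \<comment> \<open>This keeps \<open>y\<close> away from the antipode of \<open>x0\<close>, as the
    Lipschitz bound requires.\<close>
  have "1 / (2 * real n) \<le> 1 / 2" using n by (simp add: field_simps)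
  then have "geodist x0 y < pi" using y pi_gt3 by linarith
  then have "\<bar>p y - p x0\<bar> \<le> real n * \<bar>p x0\<bar> * geodist x0 y"
    using p x0 y Y by (intro sphere_polys_lipschitz) auto
  also have "\<dots> \<le> real n * \<bar>p x0\<bar> * (1 / (2 * real n))"
    using y by (intro mult_left_mono) auto
  also have "\<dots> = \<bar>p x0\<bar> / 2" using n by simp
  finally show ?thesis using m[OF y(1)] x0(2)[OF x] by linarith
qed

section \<open>The algebra of polynomials on the sphere\<close>

lemma sphere_polys_mono: "m \<le> n \<Longrightarrow> sphere_polys m \<subseteq> sphere_polys n"
  unfolding sphere_polys_def by (intro fun_vs.span_mono) auto

lemma sphere_monomial_in: "(\<Sum>i\<in>UNIV. k i) \<le> n \<Longrightarrow> sphere_monomial k \<in> sphere_polys n"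
  unfolding sphere_polys_def by (intro fun_vs.span_base) auto

lemma sphere_polys_add:
  "p \<in> sphere_polys n \<Longrightarrow> q \<in> sphere_polys n \<Longrightarrow> (\<lambda>x. p x + q x) \<in> sphere_polys n"
  unfolding sphere_polys_def using fun_vs.span_add by (fastforce simp: plus_fun_def)

lemma sphere_polys_scale: "p \<in> sphere_polys n \<Longrightarrow> (\<lambda>x. c * p x) \<in> sphere_polys n"
  unfolding sphere_polys_def by (rule fun_vs.span_scale)

lemma sphere_polys_diff:
  "p \<in> sphere_polys n \<Longrightarrow> q \<in> sphere_polys n \<Longrightarrow> (\<lambda>x. p x - q x) \<in> sphere_polys n"
  using sphere_polys_add[OF _ sphere_polys_scale[of q n "-1"]] by force

lemma sphere_polys_zero: "(\<lambda>x. 0) \<in> sphere_polys n"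
  unfolding sphere_polys_def using fun_vs.span_zero by (simp add: zero_fun_def)

lemma sphere_polys_sum:
  assumes "\<And>i. i \<in> I \<Longrightarrow> p i \<in> sphere_polys n"
  shows "(\<lambda>x. \<Sum>i\<in>I. p i x) \<in> sphere_polys n"
  using assms by (induction I rule: infinite_finite_induct)
    (auto intro: sphere_polys_add sphere_polys_zero)

text \<open>Products of monomials add exponents. The general case follows by bilinearity, exhausting
  the span in one factor at a time.\<close>

lemma sphere_polys_mult:
  assumes p: "p \<in> sphere_polys m" and q: "q \<in> sphere_polys n"
  shows "(\<lambda>x. p x * q x) \<in> sphere_polys (m + n)"
proof -
  have mono: "(\<lambda>x. sphere_monomial k x * sphere_monomial l x) \<in> sphere_polys (m + n)"
    if "(\<Sum>i\<in>UNIV. k i) \<le> m" "(\<Sum>i\<in>UNIV. l i) \<le> n" for k l :: "'a \<Rightarrow> nat"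
  proof -
    have "(\<lambda>x. sphere_monomial k x * sphere_monomial l x) = sphere_monomial (\<lambda>i. k i + l i)"
      by (auto simp: sphere_monomial_def power_add prod.distrib fun_eq_iff)
    then show ?thesis
      using that by (simp add: sphere_monomial_in sum.distrib add_mono)
  qed
  have sub: "fun_vs.subspace {p. (\<lambda>x. p x * q x) \<in> sphere_polys (m + n)}"
    for q :: "real ^ 'a \<Rightarrow> real"
    by (auto simp: fun_vs.subspace_def plus_fun_def zero_fun_def distrib_right mult.assoc
        intro: sphere_polys_zero sphere_polys_add sphere_polys_scale)
  have 1: "(\<lambda>x. p x * sphere_monomial l x) \<in> sphere_polys (m + n)"
    if "(\<Sum>i\<in>UNIV. l i) \<le> n" for l :: "'a \<Rightarrow> nat"
  proof -
    have "sphere_polys m \<subseteq> {p. (\<lambda>x. p x * sphere_monomial l x) \<in> sphere_polys (m + n)}"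
      unfolding sphere_polys_def[of m] using that by (intro fun_vs.span_minimal sub) (auto intro: mono)
    then show ?thesis using p by blast
  qed
  have "sphere_polys n \<subseteq> {q. (\<lambda>x. q x * p x) \<in> sphere_polys (m + n)}"
    unfolding sphere_polys_def[of n] using 1
    by (intro fun_vs.span_minimal sub) (auto simp: mult.commute)
  then show ?thesis using q by (auto simp: mult.commute)
qed

lemma sphere_polys_const: "(\<lambda>x. if x \<in> sphere 0 1 then c else 0) \<in> sphere_polys n"
proof -
  have "(\<lambda>x. c * sphere_monomial (\<lambda>_. 0) x) \<in> sphere_polys n"
    by (intro sphere_polys_scale sphere_monomial_in) simp
  then show ?thesis by (simp add: sphere_monomial_def if_distrib cong: if_cong)
qed

text \<open>Stone-Weierstrass supplies approximants from this inductively defined class; on the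
  sphere they have to be recognised as members of \<open>sphere_polys\<close>.\<close>

lemma real_polynomial_function_sphere:
  fixes g :: "real ^ 'n \<Rightarrow> real"
  assumes "real_polynomial_function g"
  shows "\<exists>n. \<exists>p\<in>sphere_polys n. \<forall>x\<in>sphere 0 1. g x = p x"
  using assms
proof induction
  case (linear f)
  \<comment> \<open>The exponent vector with a single 1 makes \<open>?m i\<close> the
    \<open>i\<close>-th coordinate on the sphere; a linear map combines coordinates with its values
    on the axes.\<close>
  let ?m = "\<lambda>i. sphere_monomial (\<lambda>j. of_bool (j = i)) :: real ^ 'n \<Rightarrow> real"
  have "(\<lambda>x. \<Sum>i\<in>UNIV. f (axis i 1) * ?m i x) \<in> sphere_polys 1"
    by (intro sphere_polys_sum sphere_polys_scale sphere_monomial_in) simp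
  moreover have "f x = (\<Sum>i\<in>UNIV. f (axis i 1) * ?m i x)" if "x \<in> sphere 0 1" for x
  proof -
    have m: "?m i x = x $ i" for i
    proof -
      have "?m i x = (\<Prod>j\<in>UNIV. if j = i then x $ j else 1)"
        using that by (simp add: sphere_monomial_def of_bool_def if_distrib[of "(^) _"] cong: if_cong)
      then show ?thesis by simp
    qed
    have "f x = f (\<Sum>i\<in>UNIV. x $ i *\<^sub>R axis i 1)"
      using basis_expansion[of x] by (simp add: scalar_mult_eq_scaleR)
    also have "\<dots> = (\<Sum>i\<in>UNIV. x $ i * f (axis i 1))"
      using linear by (simp add: bounded_linear.linear linear_sum linear_cmul)
    finally show ?thesis by (simp add: m mult.commute)
  qed
  ultimately show ?case
    by (intro exI[of _ 1] bexI[of _ "\<lambda>x. \<Sum>i\<in>UNIV. f (axis i 1) * ?m i x"] ballI)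
next
  case (const c)
  show ?case
    by (intro exI[of _ 0] bexI[of _ "\<lambda>x. if x \<in> sphere 0 1 then c else 0"] sphere_polys_const) simp
next
  case (add f g)
  then obtain m p n q where "p \<in> sphere_polys m" "\<forall>x\<in>sphere 0 1. f x = p x"
    "q \<in> sphere_polys n" "\<forall>x\<in>sphere 0 1. g x = q x" by blast
  moreover from this have "(\<lambda>x. p x + q x) \<in> sphere_polys (max m n)"
    using sphere_polys_mono[of m "max m n"] sphere_polys_mono[of n "max m n"]
    by (intro sphere_polys_add) auto
  ultimately show ?case
    by (intro exI[of _ "max m n"] bexI[of _ "\<lambda>x. p x + q x"]) auto
next
  case (mult f g)
  then obtain m p n q where "p \<in> sphere_polys m" "\<forall>x\<in>sphere 0 1. f x = p x"
    "q \<in> sphere_polys n" "\<forall>x\<in>sphere 0 1. g x = q x" by blast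
  then show ?case
    using sphere_polys_mult by (intro exI[of _ "m + n"] bexI[of _ "\<lambda>x. p x * q x"]) auto
qed

section \<open>The invariant measure\<close>

text \<open>With at least two coordinates, rotations of determinant 1 act transitively on the
  sphere. On the two points of the line the only such rotation is the identity.\<close>

locale sphere_measure =
  fixes \<nu> :: "(real ^ 'n) measure"
  assumes rotation_invariant: "rotation_invariant_prob \<nu>"
    and dim_ge_2: "CARD('n) \<ge> 2"

sublocale sphere_measure \<subseteq> prob_space \<nu>
  using rotation_invariant by (simp add: rotation_invariant_prob_def)

context sphere_measure
begin

abbreviation Sph :: "(real ^ 'n) set" where "Sph \<equiv> sphere 0 1"

lemma space_nu: "space \<nu> = Sph"
  and sets_nu: "sets \<nu> = sets (restrict_space borel Sph)"
  and distr_rotation: "rotation_matrix A \<Longrightarrow> distr \<nu> \<nu> ((*v) A) = \<nu>"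
  using rotation_invariant by (auto simp: rotation_invariant_prob_def)

lemma measurable_continuous:
  fixes f :: "real ^ 'n \<Rightarrow> real"
  assumes "continuous_on Sph f"
  shows "f \<in> borel_measurable \<nu>"
  using borel_measurable_continuous_on_restrict[OF assms]
    measurable_cong_sets[OF sets_nu refl] by blast

lemma sphere_nonempty: "\<exists>x. x \<in> Sph"
  using not_empty unfolding space_nu by blast

lemma continuous_bounded:
  fixes f :: "real ^ 'n \<Rightarrow> real"
  assumes f: "continuous_on Sph f"
  obtains b where "\<And>x. x \<in> Sph \<Longrightarrow> \<bar>f x\<bar> \<le> b" "b \<ge> 0"
proof -
  have "bounded (f ` Sph)"
    using compact_continuous_image[OF f compact_sphere] compact_imp_bounded by blast
  then show ?thesis
    using that unfolding bounded_pos by (metis imageI less_imp_le real_norm_def)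
qed

lemma integrable_continuous:
  fixes f :: "real ^ 'n \<Rightarrow> real"
  assumes f: "continuous_on Sph f"
  shows "integrable \<nu> f"
proof -
  obtain b where "\<And>x. x \<in> Sph \<Longrightarrow> \<bar>f x\<bar> \<le> b"
    using continuous_bounded[OF f] by blast
  then show ?thesis
    using measurable_continuous[OF f] by (intro integrable_const_bound[of _ b]) (auto simp: space_nu)
qed

text \<open>If one nonempty relatively open set were null, so would be its preimages under
  rotations. By transitivity these cover the sphere, compactness selects finitely many, and the
  total mass would be 0 instead of 1.\<close>

lemma open_Int_sphere_pos:
  assumes U: "open U" "U \<inter> Sph \<noteq> {}"
  shows "emeasure \<nu> (U \<inter> Sph) \<noteq> 0"
proof
  assume null: "emeasure \<nu> (U \<inter> Sph) = 0"
  have Usets: "V \<inter> Sph \<in> sets \<nu>" if "open V" for V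
    using that by (auto simp: sets_nu sets_restrict_space)
  obtain x0 where x0: "x0 \<in> U" "x0 \<in> Sph" using U by blast
  have "\<exists>V. open V \<and> z \<in> V \<and> V \<inter> Sph \<in> null_sets \<nu>" if z: "z \<in> Sph" for z
  proof -
    \<comment> \<open>\<open>g\<close> carries \<open>z\<close> to the point \<open>x0\<close> of
      \<open>U\<close>, so the preimage of \<open>U\<close> is a null neighbourhood of
      \<open>z\<close>.\<close>
    obtain g where g: "orthogonal_transformation g" "det (matrix g) = 1" "g z = x0"
      using rotation_exists[OF dim_ge_2, of z x0] z x0 by auto
    then have lin: "linear g" by (simp add: orthogonal_transformation_def)
    have rot: "rotation_matrix (matrix g)"
      using g by (simp add: rotation_matrix_def orthogonal_transformation_matrix)
    have mv: "(*v) (matrix g) = g"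
      using lin by (auto simp: matrix_works)
    have ng: "norm (g w) = norm w" for w
      using g by (simp add: orthogonal_transformation)
    have cont: "continuous_on UNIV g"
      using lin linear_continuous_on linear_conv_bounded_linear by blast
    have meas: "g \<in> measurable \<nu> \<nu>"
    proof -
      have "g \<in> measurable borel borel"
        using cont borel_measurable_continuous_onI by blast
      then have "g \<in> measurable (restrict_space borel Sph) (restrict_space borel Sph)"
        by (intro measurable_restrict_space3) (auto simp: ng)
      then show ?thesis
        using measurable_cong_sets[OF sets_nu sets_nu] by blast
    qed
    have "emeasure \<nu> (U \<inter> Sph) = emeasure (distr \<nu> \<nu> g) (U \<inter> Sph)"
      using distr_rotation[OF rot] by (simp add: mv)
    also have "\<dots> = emeasure \<nu> (g -` (U \<inter> Sph) \<inter> space \<nu>)"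
      using meas Usets[OF U(1)] by (rule emeasure_distr)
    also have "g -` (U \<inter> Sph) \<inter> space \<nu> = (g -` U) \<inter> Sph"
      by (auto simp: space_nu ng)
    finally have "emeasure \<nu> (g -` U \<inter> Sph) = 0" using null by simp
    moreover have "open (g -` U)"
      using cont U(1) by (simp add: open_vimage)
    ultimately show ?thesis
      using g x0 Usets by (intro exI[of _ "g -` U"]) (auto simp: null_sets_def)
  qed
  then obtain V where V: "\<And>z. z \<in> Sph \<Longrightarrow> open (V z) \<and> z \<in> V z \<and> V z \<inter> Sph \<in> null_sets \<nu>"
    by metis
  obtain D where D: "D \<subseteq> Sph" "finite D" "Sph \<subseteq> (\<Union>z\<in>D. V z)"
    using compactE_image[OF compact_sphere, of Sph V] V by (metis UN_I subsetI)
  have "(\<Union>z\<in>D. V z \<inter> Sph) \<in> null_sets \<nu>"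
    using D V by (intro null_sets.finite_UN) auto
  also have "(\<Union>z\<in>D. V z \<inter> Sph) = space \<nu>"
    using D by (auto simp: space_nu)
  finally show False
    using emeasure_space_1 by auto
qed

text \<open>The set where \<open>g\<close> exceeds \<open>c\<close> is relatively open, so it is
  empty or of positive measure.\<close>

lemma AE_le_imp_le:
  fixes g :: "real ^ 'n \<Rightarrow> real"
  assumes g: "continuous_on Sph g" and ae: "AE x in \<nu>. g x \<le> c" and x: "x \<in> Sph"
  shows "g x \<le> c"
proof (rule ccontr)
  assume "\<not> g x \<le> c"
  obtain U where U: "open U" "U \<inter> Sph = g -` {c<..} \<inter> Sph"
    using g open_greaterThan[of c] unfolding continuous_on_open_invariant by blast
  have "x \<in> U \<inter> Sph"
    unfolding U(2) using x \<open>\<not> g x \<le> c\<close> by simp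
  then have "emeasure \<nu> (U \<inter> Sph) \<noteq> 0"
    using U(1) by (intro open_Int_sphere_pos) auto
  moreover have "emeasure \<nu> (U \<inter> Sph) = 0"
  proof -
    have m: "U \<inter> Sph \<in> sets \<nu>"
      using U(1) by (auto simp: sets_nu sets_restrict_space)
    have e: "{x \<in> space \<nu>. \<not> g x \<le> c} = U \<inter> Sph"
      unfolding U(2) by (auto simp: space_nu)
    show ?thesis using AE_iff_measurable[OF m e] ae by blast
  qed
  ultimately show False by blast
qed

section \<open>Essential supremum of continuous functions\<close>

lemma Linf_nrm_le:
  fixes g :: "real ^ 'n \<Rightarrow> real"
  assumes g: "continuous_on Sph g" and M: "\<And>x. x \<in> Sph \<Longrightarrow> \<bar>g x\<bar> \<le> M"
  shows "Linf_nrm \<nu> g \<le> M"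
proof -
  have [measurable]: "g \<in> borel_measurable \<nu>" by (rule measurable_continuous[OF g])
  have "esssup \<nu> (\<lambda>x. ereal \<bar>g x\<bar>) \<le> ereal M"
    using M by (intro esssup_I) (auto simp: space_nu)
  \<comment> \<open>\<open>real_of_ereal\<close> sends an infinite value to 0, so the case of minus
    infinity needs a nonnegative \<open>M\<close>.\<close>
  moreover have "M \<ge> 0"
    using M sphere_nonempty by (meson abs_ge_zero order_trans)
  ultimately show ?thesis
    unfolding Linf_nrm_def
    by (cases "esssup \<nu> (\<lambda>x. ereal \<bar>g x\<bar>)") auto
qed

lemma le_Linf_nrm:
  fixes g :: "real ^ 'n \<Rightarrow> real"
  assumes g: "continuous_on Sph g" and x: "x \<in> Sph"
  shows "\<bar>g x\<bar> \<le> Linf_nrm \<nu> g"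
proof -
  have [measurable]: "g \<in> borel_measurable \<nu>" by (rule measurable_continuous[OF g])
  have cont: "continuous_on Sph (\<lambda>x. \<bar>g x\<bar>)" using g by (intro continuous_intros)
  obtain b where b: "\<And>x. x \<in> Sph \<Longrightarrow> \<bar>g x\<bar> \<le> b"
    using continuous_bounded[OF g] by blast
  let ?e = "esssup \<nu> (\<lambda>x. ereal \<bar>g x\<bar>)"
  have "?e \<le> ereal b"
    using b by (intro esssup_I) (auto simp: space_nu)
  moreover have ae: "AE x in \<nu>. ereal \<bar>g x\<bar> \<le> ?e" by (rule esssup_AE)
  \<comment> \<open>Finiteness comes before \<open>real_of_ereal\<close> can be read as the actual
    essential supremum.\<close>
  moreover have "?e \<noteq> - \<infinity>"
  proof
    assume "?e = - \<infinity>"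
    then have "AE x in \<nu>. False" using ae by simp
    then show False by simp
  qed
  ultimately obtain r where r: "?e = ereal r" by (cases ?e) auto
  then have "AE x in \<nu>. \<bar>g x\<bar> \<le> r" using ae by simp
  then show ?thesis
    using AE_le_imp_le[OF cont _ x] by (simp add: Linf_nrm_def r)
qed

section \<open>The L2 inner product on continuous functions\<close>

lemma L2_inner_commute: "L2_inner \<nu> f g = L2_inner \<nu> g f"
  by (simp add: L2_inner_def mult.commute)

lemma L2_inner_cong:
  "(\<And>x. x \<in> Sph \<Longrightarrow> f x = f' x) \<Longrightarrow> L2_inner \<nu> f g = L2_inner \<nu> f' g"
  unfolding L2_inner_def by (intro Bochner_Integration.integral_cong) (auto simp: space_nu)

lemma L2_inner_add:
  fixes f g h :: "real ^ 'n \<Rightarrow> real"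
  assumes "continuous_on Sph f" "continuous_on Sph g" "continuous_on Sph h"
  shows "L2_inner \<nu> (\<lambda>x. f x + g x) h = L2_inner \<nu> f h + L2_inner \<nu> g h"
  unfolding L2_inner_def distrib_right
  using assms by (intro Bochner_Integration.integral_add integrable_continuous continuous_intros)

lemma L2_inner_diff:
  fixes f g h :: "real ^ 'n \<Rightarrow> real"
  assumes "continuous_on Sph f" "continuous_on Sph g" "continuous_on Sph h"
  shows "L2_inner \<nu> (\<lambda>x. f x - g x) h = L2_inner \<nu> f h - L2_inner \<nu> g h"
  unfolding L2_inner_def left_diff_distrib
  using assms by (intro Bochner_Integration.integral_diff integrable_continuous continuous_intros)

lemma L2_inner_scale: "L2_inner \<nu> (\<lambda>x. c * f x) h = c * L2_inner \<nu> f h"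
  by (simp add: L2_inner_def mult.assoc)

lemma L2_inner_sum:
  fixes f :: "'i \<Rightarrow> real ^ 'n \<Rightarrow> real"
  assumes "\<And>i. i \<in> I \<Longrightarrow> continuous_on Sph (f i)" "continuous_on Sph h"
  shows "L2_inner \<nu> (\<lambda>x. \<Sum>i\<in>I. f i x) h = (\<Sum>i\<in>I. L2_inner \<nu> (f i) h)"
  unfolding L2_inner_def sum_distrib_right
  using assms by (intro Bochner_Integration.integral_sum integrable_continuous continuous_intros)

lemma L2_inner_self_eq_0:
  fixes w :: "real ^ 'n \<Rightarrow> real"
  assumes w: "continuous_on Sph w" and 0: "L2_inner \<nu> w w = 0" and x: "x \<in> Sph"
  shows "w x = 0"
proof -
  have cont: "continuous_on Sph (\<lambda>x. w x * w x)" using w by (intro continuous_intros)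
  have "AE x in \<nu>. w x * w x = 0"
    using integral_nonneg_eq_0_iff_AE[OF integrable_continuous[OF cont]] 0
    by (simp add: L2_inner_def)
  then have "AE x in \<nu>. w x * w x \<le> 0" by eventually_elim simp
  then have "w x * w x \<le> 0" by (rule AE_le_imp_le[OF cont _ x])
  then show ?thesis by (auto simp: mult_le_0_iff)
qed

lemma abs_L2_inner_le:
  fixes f g :: "real ^ 'n \<Rightarrow> real"
  assumes "continuous_on Sph f" "continuous_on Sph g"
    "\<And>x. x \<in> Sph \<Longrightarrow> \<bar>f x * g x\<bar> \<le> M"
  shows "\<bar>L2_inner \<nu> f g\<bar> \<le> M"
proof -
  have int: "integrable \<nu> (\<lambda>x. f x * g x)"
    using assms by (intro integrable_continuous continuous_intros)
  have "\<bar>L2_inner \<nu> f g\<bar> \<le> (\<integral>x. \<bar>f x * g x\<bar> \<partial>\<nu>)"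
    unfolding L2_inner_def by (rule integral_abs_bound)
  also have "\<dots> \<le> (\<integral>x. M \<partial>\<nu>)"
    using int assms(3) by (intro integral_mono) (auto simp: space_nu)
  finally show ?thesis using prob_space by simp
qed

text \<open>The majorant gives uniform convergence, hence continuity of the sum; with the bounded
  factor \<open>h\<close> it also dominates the series of integrals, so sum and integral may be
  exchanged.\<close>

lemma L2_inner_suminf:
  fixes g :: "nat \<Rightarrow> real ^ 'n \<Rightarrow> real"
  assumes g: "\<And>k. continuous_on Sph (g k)" and h: "continuous_on Sph h"
    and m: "summable m" "\<And>k x. x \<in> Sph \<Longrightarrow> \<bar>g k x\<bar> \<le> m k"
  shows "continuous_on Sph (\<lambda>x. \<Sum>k. g k x)"
    and "(\<lambda>k. L2_inner \<nu> (g k) h) sums L2_inner \<nu> (\<lambda>x. \<Sum>k. g k x) h"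
proof -
  have u: "uniform_limit Sph (\<lambda>n x. \<Sum>k<n. g k x) (\<lambda>x. \<Sum>k. g k x) sequentially"
    using m by (intro Weierstrass_m_test) auto
  then show c: "continuous_on Sph (\<lambda>x. \<Sum>k. g k x)"
    by (rule uniform_limit_theorem[rotated]) (auto intro!: always_eventually continuous_intros g)
  obtain b where b: "\<And>x. x \<in> Sph \<Longrightarrow> \<bar>h x\<bar> \<le> b" and b0: "b \<ge> 0"
    using continuous_bounded[OF h] by blast
  have sm: "summable (\<lambda>k. \<bar>g k x\<bar>)" if "x \<in> Sph" for x
    using m that by (intro summable_comparison_test'[OF m(1)]) auto
  have mn: "0 \<le> m k" for k
    using m(2)[of _ k] sphere_nonempty by (meson abs_ge_zero order_trans)
  have "(\<lambda>k. \<integral>x. g k x * h x \<partial>\<nu>) sums (\<integral>x. (\<Sum>k. g k x * h x) \<partial>\<nu>)"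
  proof (rule sums_integral)
    show "integrable \<nu> (\<lambda>x. g k x * h x)" for k
      by (intro integrable_continuous continuous_intros g h)
    show "AE x in \<nu>. summable (\<lambda>k. norm (g k x * h x))"
      using sm by (auto simp: space_nu abs_mult intro!: AE_I2 summable_mult2)
    show "summable (\<lambda>k. \<integral>x. norm (g k x * h x) \<partial>\<nu>)"
    proof (rule summable_comparison_test'[of "\<lambda>k. m k * b" 0])
      show "summable (\<lambda>k. m k * b)" using m by (intro summable_mult2)
      fix k
      have "(\<integral>x. norm (g k x * h x) \<partial>\<nu>) \<le> (\<integral>x. m k * b \<partial>\<nu>)"
        using b m(2) mn b0
        by (intro integral_mono integrable_norm integrable_continuous continuous_intros g h)
          (simp_all add: space_nu abs_mult mult_mono)
      then show "norm (\<integral>x. norm (g k x * h x) \<partial>\<nu>) \<le> m k * b"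
        using prob_space by simp
    qed
  qed
  moreover have "(\<integral>x. (\<Sum>k. g k x * h x) \<partial>\<nu>) = (\<integral>x. (\<Sum>k. g k x) * h x \<partial>\<nu>)"
    using sm
    by (intro Bochner_Integration.integral_cong refl) (simp add: space_nu suminf_mult2[symmetric] summable_rabs_cancel)
  ultimately show "(\<lambda>k. L2_inner \<nu> (g k) h) sums L2_inner \<nu> (\<lambda>x. \<Sum>k. g k x) h"
    by (simp add: L2_inner_def)
qed
end

section \<open>Spherical harmonics\<close>

context sphere_measure
begin

lemma harmonics_continuous: "h \<in> harmonics \<nu> n \<Longrightarrow> continuous_on Sph h"
  by (auto simp: harmonics_def intro: sphere_polys_continuous)

lemma harmonics_orthogonal:
  assumes "h \<in> harmonics \<nu> m" "g \<in> harmonics \<nu> n" "m \<noteq> n"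
  shows "L2_inner \<nu> h g = 0"
proof (cases "m < n")
  case True
  then have "L2_inner \<nu> g h = 0" using assms by (simp add: harmonics_def)
  then show ?thesis by (simp add: L2_inner_commute)
next
  case False
  with assms(3) have "n < m" by simp
  then show ?thesis using assms by (simp add: harmonics_def)
qed

lemma harmonics_add:
  assumes "h \<in> harmonics \<nu> n" "g \<in> harmonics \<nu> n"
  shows "(\<lambda>x. h x + g x) \<in> harmonics \<nu> n"
  using assms L2_inner_add[OF harmonics_continuous harmonics_continuous sphere_polys_continuous]
  by (auto simp: harmonics_def sphere_polys_add)

lemma harmonics_scale: "h \<in> harmonics \<nu> n \<Longrightarrow> (\<lambda>x. c * h x) \<in> harmonics \<nu> n"
  by (auto simp: harmonics_def sphere_polys_scale L2_inner_scale)

lemma harmonics_zero: "(\<lambda>x. 0) \<in> harmonics \<nu> n"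
  by (auto simp: harmonics_def sphere_polys_zero L2_inner_def)

lemma harmonics_sum:
  assumes "\<And>i. i \<in> I \<Longrightarrow> h i \<in> harmonics \<nu> n"
  shows "(\<lambda>x. \<Sum>i\<in>I. h i x) \<in> harmonics \<nu> n"
  using assms by (induction I rule: infinite_finite_induct)
    (auto intro: harmonics_add harmonics_zero)

end

text \<open>A basis is fixed in every degree so that projections become finite Fourier sums; the
  polynomials \<open>C n\<close> supply the addition formula.\<close>

locale harmonic_basis = sphere_measure \<nu> for \<nu> :: "(real ^ 'n) measure" +
  fixes B :: "nat \<Rightarrow> nat \<Rightarrow> real ^ 'n \<Rightarrow> real" and C :: "nat \<Rightarrow> real poly"
  assumes onb: "harmonic_onb \<nu> n (B n)"
    and gegenbauer: "normalised_gegenbauer \<nu> n (B n) (C n)"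
begin

abbreviation "idx n \<equiv> {1..harmonic_dim \<nu> n}"

definition comb :: "nat \<Rightarrow> (nat \<Rightarrow> real) \<Rightarrow> real ^ 'n \<Rightarrow> real" where
  "comb n c x = (\<Sum>j\<in>idx n. c j * B n j x)"

definition coef :: "(real ^ 'n \<Rightarrow> real) \<Rightarrow> nat \<Rightarrow> nat \<Rightarrow> real" where
  "coef f n j = L2_inner \<nu> f (B n j)"

section \<open>Coordinates in an orthonormal basis of harmonics\<close>

lemma B_harmonics:
  assumes "j \<in> idx n"
  shows "B n j \<in> harmonics \<nu> n"
proof -
  have "B n j \<in> fun_vs.span (B n ` idx n)"
    using assms by (intro fun_vs.span_base imageI)
  then show ?thesis using onb[of n] unfolding harmonic_onb_def by argo
qed

lemma B_continuous: "j \<in> idx n \<Longrightarrow> continuous_on Sph (B n j)"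
  using B_harmonics harmonics_continuous by blast

lemma B_orthonormal:
  assumes "i \<in> idx m" "j \<in> idx n"
  shows "L2_inner \<nu> (B m i) (B n j) = of_bool (m = n \<and> i = j)"
proof (cases "m = n")
  case True
  then show ?thesis using onb[of n] assms by (simp add: harmonic_onb_def)
next
  case False
  then show ?thesis using harmonics_orthogonal[OF B_harmonics[OF assms(1)] B_harmonics[OF assms(2)]] by simp
qed

lemma comb_harmonics: "comb n c \<in> harmonics \<nu> n"
  unfolding comb_def[abs_def] by (intro harmonics_sum harmonics_scale B_harmonics)

lemma comb_continuous: "continuous_on Sph (comb n c)"
  using comb_harmonics harmonics_continuous by blast

lemma L2_inner_comb:
  assumes f: "continuous_on Sph f"
  shows "L2_inner \<nu> f (comb n c) = (\<Sum>j\<in>idx n. c j * coef f n j)"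
proof -
  have "L2_inner \<nu> (comb n c) f = (\<Sum>j\<in>idx n. L2_inner \<nu> (\<lambda>x. c j * B n j x) f)"
    unfolding comb_def[abs_def]
    by (intro L2_inner_sum f continuous_intros B_continuous)
  then show ?thesis
    by (simp add: L2_inner_scale coef_def L2_inner_commute)
qed

lemma L2_inner_comb_left:
  "continuous_on Sph f \<Longrightarrow> L2_inner \<nu> (comb n c) f = (\<Sum>j\<in>idx n. c j * coef f n j)"
  using L2_inner_comb by (simp add: L2_inner_commute)

lemma coef_comb:
  assumes "i \<in> idx m"
  shows "coef (comb n c) m i = (if n = m then c i else 0)"
proof -
  have "coef (comb n c) m i = L2_inner \<nu> (B m i) (comb n c)"
    by (simp add: coef_def L2_inner_commute)
  also have "\<dots> = (\<Sum>j\<in>idx n. c j * L2_inner \<nu> (B m i) (B n j))"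
    using assms by (simp add: L2_inner_comb B_continuous coef_def)
  also have "\<dots> = (\<Sum>j\<in>idx n. if j = i then (if n = m then c j else 0) else 0)"
    using assms by (intro sum.cong refl) (auto simp: B_orthonormal)
  also have "\<dots> = (if n = m then c i else 0)"
    using assms by (subst sum.delta) auto
  finally show ?thesis .
qed

lemma harmonics_eq_comb:
  assumes "h \<in> harmonics \<nu> n"
  shows "h = comb n (coef h n)"
proof -
  let ?G = "{h. \<exists>c. h = comb n c}"
  have "fun_vs.subspace ?G"
    unfolding fun_vs.subspace_def
  proof (intro conjI ballI allI)
    show "0 \<in> ?G"
      by (intro CollectI exI[of _ "\<lambda>_. 0"]) (auto simp: comb_def fun_eq_iff)
    show "f + g \<in> ?G" if fg: "f \<in> ?G" "g \<in> ?G" for f g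
    proof -
      obtain c e where "f = comb n c" "g = comb n e" using fg by blast
      then have "f + g = comb n (\<lambda>j. c j + e j)"
        by (auto simp: comb_def fun_eq_iff distrib_right sum.distrib)
      then show ?thesis by auto
    qed
    show "(\<lambda>x. r * f x) \<in> ?G" if f: "f \<in> ?G" for f and r :: real
    proof -
      obtain c where "f = comb n c" using f by blast
      then have "(\<lambda>x. r * f x) = comb n (\<lambda>j. r * c j)"
        by (auto simp: comb_def fun_eq_iff sum_distrib_left mult.assoc)
      then show ?thesis by auto
    qed
  qed
  moreover have "B n ` idx n \<subseteq> ?G"
  proof clarify
    fix i assume "i \<in> idx n"
    then have "B n i x = comb n (\<lambda>j. of_bool (j = i)) x" for x
      by (simp add: comb_def of_bool_def if_distrib[of "\<lambda>c. c * _"] sum.delta cong: if_cong)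
    then show "\<exists>c. B n i = comb n c" by blast
  qed
  ultimately have "fun_vs.span (B n ` idx n) \<subseteq> ?G" by (intro fun_vs.span_minimal)
  then obtain c where c: "h = comb n c"
    using assms onb[of n] by (auto simp: harmonic_onb_def)
  have "comb n c x = comb n (coef (comb n c) n) x" for x
    unfolding comb_def[of _ _ x] by (intro sum.cong refl) (simp add: coef_comb)
  then show ?thesis unfolding c by (rule ext)
qed

text \<open>This resolves the definite description in \<open>harmonic_proj\<close>: the Fourier sum
  satisfies the defining condition, and testing against the basis shows that nothing else
  does.\<close>

lemma harmonic_proj_eq:
  assumes f: "continuous_on Sph f"
  shows "harmonic_proj \<nu> n f = comb n (coef f n)"
  unfolding harmonic_proj_def
proof (rule the_equality)
  have "L2_inner \<nu> f h = L2_inner \<nu> (comb n (coef f n)) h" if h: "h \<in> harmonics \<nu> n" for h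
  proof -
    have L: "L2_inner \<nu> g h = (\<Sum>j\<in>idx n. coef h n j * coef g n j)" if "continuous_on Sph g" for g
      using L2_inner_comb[OF that, of n "coef h n"] by (simp flip: harmonics_eq_comb[OF h])
    have "L2_inner \<nu> f h = (\<Sum>j\<in>idx n. coef h n j * coef f n j)"
      by (rule L[OF f])
    also have "\<dots> = (\<Sum>j\<in>idx n. coef h n j * coef (comb n (coef f n)) n j)"
      by (intro sum.cong refl) (simp add: coef_comb)
    also have "\<dots> = L2_inner \<nu> (comb n (coef f n)) h"
      by (rule L[OF comb_continuous, symmetric])
    finally show ?thesis .
  qed
  then show "comb n (coef f n) \<in> harmonics \<nu> n \<and>
      (\<forall>h\<in>harmonics \<nu> n. L2_inner \<nu> f h = L2_inner \<nu> (comb n (coef f n)) h)"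
    using comb_harmonics by blast
next
  fix g
  assume g: "g \<in> harmonics \<nu> n \<and> (\<forall>h\<in>harmonics \<nu> n. L2_inner \<nu> f h = L2_inner \<nu> g h)"
  then have "coef g n j = coef f n j" if "j \<in> idx n" for j
    using B_harmonics[OF that] by (simp add: coef_def)
  then have "comb n (coef g n) = comb n (coef f n)"
    by (auto simp: comb_def fun_eq_iff)
  then show "g = comb n (coef f n)" using harmonics_eq_comb g by metis
qed

lemma L2_nrm_comb: "L2_nrm \<nu> (comb n c) = L2_set c (idx n)"
  by (simp add: L2_nrm_def L2_set_def L2_inner_comb comb_continuous coef_comb power2_eq_square)

lemma kernel_eq:
  assumes "x \<in> Sph" "y \<in> Sph"
  shows "poly (C n) (x \<bullet> y) = comb n (\<lambda>j. B n j y) x"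
  using gegenbauer[of n] assms by (simp add: normalised_gegenbauer_def comb_def mult.commute)

text \<open>On the diagonal the addition formula gives \<open>poly (C n) 1\<close>, the same at
  every point. Averaging over the sphere identifies this constant as the sum of the squared norms of
  the basis functions, that is, the dimension.\<close>

lemma L2_set_B:
  assumes "x \<in> Sph"
  shows "L2_set (\<lambda>j. B n j x) (idx n) = sqrt (harmonic_dim \<nu> n)"
proof -
  have eq: "(\<Sum>j\<in>idx n. (B n j z)\<^sup>2) = poly (C n) 1" if "z \<in> Sph" for z
    using kernel_eq[OF that that, of n] that by (simp add: comb_def power2_eq_square norm_eq_1)
  have "poly (C n) 1 = (\<integral>z. poly (C n) 1 \<partial>\<nu>)"
    using prob_space by simp
  also have "\<dots> = (\<integral>z. (\<Sum>j\<in>idx n. (B n j z)\<^sup>2) \<partial>\<nu>)"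
    by (intro Bochner_Integration.integral_cong refl) (simp only: eq space_nu)
  also have "\<dots> = (\<Sum>j\<in>idx n. L2_inner \<nu> (B n j) (B n j))"
    unfolding L2_inner_def power2_eq_square
    by (intro Bochner_Integration.integral_sum integrable_continuous continuous_intros B_continuous)
  also have "\<dots> = real (harmonic_dim \<nu> n)"
    by (simp add: B_orthonormal)
  finally show ?thesis
    using eq[OF assms] by (simp add: L2_set_def)
qed

text \<open>Cauchy-Schwarz between the coordinates and the vector of basis values, whose length is
  \<open>sqrt d\<^sub>n\<close> at every point.\<close>

lemma abs_comb_le:
  assumes "x \<in> Sph"
  shows "\<bar>comb n c x\<bar> \<le> L2_nrm \<nu> (comb n c) * sqrt (harmonic_dim \<nu> n)"
proof -
  have "\<bar>comb n c x\<bar> \<le> (\<Sum>j\<in>idx n. \<bar>c j\<bar> * \<bar>B n j x\<bar>)"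
    unfolding comb_def by (rule order_trans[OF sum_abs]) (simp add: abs_mult)
  also have "\<dots> \<le> L2_set c (idx n) * L2_set (\<lambda>j. B n j x) (idx n)"
    by (rule L2_set_mult_ineq)
  finally show ?thesis using L2_set_B[OF assms] by (simp add: L2_nrm_comb)
qed

lemma coef_diff:
  assumes "continuous_on Sph f" "continuous_on Sph g" "j \<in> idx n"
  shows "coef (\<lambda>x. f x - g x) n j = coef f n j - coef g n j"
  using assms by (simp add: coef_def L2_inner_diff B_continuous)

lemma coef_partial_sum:
  assumes "j \<in> idx m"
  shows "coef (\<lambda>x. \<Sum>k<n. comb k (c k) x) m j = (if m < n then c m j else 0)"
proof -
  have "coef (\<lambda>x. \<Sum>k<n. comb k (c k) x) m j = (\<Sum>k<n. coef (comb k (c k)) m j)"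
    using assms unfolding coef_def by (intro L2_inner_sum comb_continuous B_continuous)
  also have "\<dots> = (\<Sum>k<n. if k = m then c k j else 0)"
    using assms by (intro sum.cong refl) (auto simp: coef_comb)
  also have "\<dots> = (if m < n then c m j else 0)"
    by (subst sum.delta) auto
  finally show ?thesis .
qed

lemma comb_sphere_polys: "k \<le> n \<Longrightarrow> comb k c \<in> sphere_polys n"
  using comb_harmonics sphere_polys_mono by (fastforce simp: harmonics_def)

text \<open>Harmonics are defined by orthogonality alone, so that they exhaust the polynomials needs
  an argument. Removing the components below \<open>n\<close> leaves a remainder orthogonal to all
  lower basis functions; by induction these span the lower polynomials, so the remainder is harmonic
  of degree \<open>n\<close>.\<close>

lemma sphere_polys_decomp:
  "p \<in> sphere_polys n \<Longrightarrow> p = (\<lambda>x. \<Sum>k<Suc n. comb k (coef p k) x)"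
proof (induction n arbitrary: p rule: less_induct)
  case (less n)
  define q where "q = (\<lambda>x. \<Sum>k<n. comb k (coef p k) x)"
  define h where "h = (\<lambda>x. p x - q x)"
  have pc: "continuous_on Sph p" using less.prems by (rule sphere_polys_continuous)
  have q: "q \<in> sphere_polys n"
    unfolding q_def by (intro sphere_polys_sum comb_sphere_polys) auto
  then have qc: "continuous_on Sph q" by (rule sphere_polys_continuous)
  have h: "h \<in> sphere_polys n" unfolding h_def using less.prems q by (rule sphere_polys_diff)
  then have hc: "continuous_on Sph h" by (rule sphere_polys_continuous)
  have ch: "coef h k j = (if k < n then 0 else coef p k j)" if "j \<in> idx k" for k j
    using coef_partial_sum[OF that, where n = n and c = "coef p"] coef_diff[OF pc qc that]
    by (simp add: h_def q_def)
  have "L2_inner \<nu> h r = 0" if m: "m < n" and r: "r \<in> sphere_polys m" for m r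
  proof -
    have "L2_inner \<nu> r h = L2_inner \<nu> (\<lambda>x. \<Sum>k<Suc m. comb k (coef r k) x) h"
      by (rule arg_cong[OF less.IH[OF m r], of "\<lambda>r. L2_inner \<nu> r h"])
    also have "\<dots> = (\<Sum>k<Suc m. L2_inner \<nu> (comb k (coef r k)) h)"
      by (intro L2_inner_sum comb_continuous hc)
    also have "\<dots> = (\<Sum>k<Suc m. \<Sum>j\<in>idx k. coef r k j * coef h k j)"
      by (simp only: L2_inner_comb_left[OF hc])
    also have "\<dots> = 0" using m by (intro sum.neutral ballI) (simp add: ch)
    finally show ?thesis by (simp add: L2_inner_commute)
  qed
  then have "h \<in> harmonics \<nu> n" using h by (auto simp: harmonics_def)
  then have "h = comb n (coef h n)" by (rule harmonics_eq_comb)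
  also have "\<dots> = comb n (coef p n)"
    by (auto simp: comb_def fun_eq_iff ch)
  finally have "h x = comb n (coef p n) x" for x by (rule fun_cong)
  then have "p x = (\<Sum>k<n. comb k (coef p k) x) + comb n (coef p n) x" for x
    by (simp add: h_def q_def algebra_simps)
  then show ?case unfolding sum.lessThan_Suc by (rule ext)
qed

text \<open>Completeness of the harmonics: \<open>w\<close> is orthogonal to every polynomial
  \<open>p\<close>, so its inner product with itself equals the one with \<open>w - p\<close>, which
  uniform approximation makes arbitrarily small.\<close>

lemma continuous_eq_0:
  assumes w: "continuous_on Sph w" and 0: "\<And>n j. j \<in> idx n \<Longrightarrow> coef w n j = 0"
    and x: "x \<in> Sph"
  shows "w x = 0"
proof -
  have poly0: "L2_inner \<nu> w p = 0" if p: "p \<in> sphere_polys n" for p n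
  proof -
    have "L2_inner \<nu> p w = L2_inner \<nu> (\<lambda>x. \<Sum>k<Suc n. comb k (coef p k) x) w"
      by (rule arg_cong[OF sphere_polys_decomp[OF p], of "\<lambda>p. L2_inner \<nu> p w"])
    also have "\<dots> = (\<Sum>k<Suc n. L2_inner \<nu> (comb k (coef p k)) w)"
      by (intro L2_inner_sum comb_continuous w)
    also have "\<dots> = (\<Sum>k<Suc n. \<Sum>j\<in>idx k. coef p k j * coef w k j)"
      by (simp only: L2_inner_comb_left[OF w])
    also have "\<dots> = 0" by (intro sum.neutral ballI) (simp add: 0)
    finally show ?thesis by (simp add: L2_inner_commute)
  qed
  obtain b where b: "\<And>x. x \<in> Sph \<Longrightarrow> \<bar>w x\<bar> \<le> b" "b \<ge> 0"
    using continuous_bounded[OF w] by blast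
  have small: "\<bar>L2_inner \<nu> w w\<bar> \<le> e * b" if e: "e > 0" for e
  proof -
    obtain g where g: "real_polynomial_function g" "\<And>x. x \<in> Sph \<Longrightarrow> \<bar>w x - g x\<bar> < e"
      using Stone_Weierstrass_real_polynomial_function[OF compact_sphere w e] by blast
    obtain n p where p: "p \<in> sphere_polys n" "\<forall>x\<in>Sph. g x = p x"
      using real_polynomial_function_sphere[OF g(1)] by blast
    have pc: "continuous_on Sph p" using p(1) by (rule sphere_polys_continuous)
    have "L2_inner \<nu> w w = L2_inner \<nu> (\<lambda>x. w x - p x) w"
      using poly0[OF p(1)] by (simp add: L2_inner_diff[OF w pc w] L2_inner_commute[of p w])
    also have "\<bar>\<dots>\<bar> \<le> e * b"
    proof (rule abs_L2_inner_le)
      show "continuous_on Sph (\<lambda>x. w x - p x)" using w pc by (intro continuous_intros)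
      fix z assume "z \<in> Sph"
      then show "\<bar>(w z - p z) * w z\<bar> \<le> e * b"
        using g(2)[of z] p(2) b(1)[of z] e unfolding abs_mult by (intro mult_mono) auto
    qed (rule w)
    finally show ?thesis .
  qed
  have "\<bar>L2_inner \<nu> w w\<bar> \<le> 0"
  proof (rule field_le_epsilon)
    fix e :: real assume "e > 0"
    \<comment> \<open>Dividing by \<open>b + 1\<close> allows for \<open>b = 0\<close>.\<close>
    then have "\<bar>L2_inner \<nu> w w\<bar> \<le> e / (b + 1) * b" using small[of "e / (b + 1)"] b by simp
    also have "\<dots> \<le> e" using b \<open>e > 0\<close> by (simp add: field_simps)
    finally show "\<bar>L2_inner \<nu> w w\<bar> \<le> 0 + e" by simp
  qed
  then show ?thesis using L2_inner_self_eq_0[OF w _ x] by simp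
qed

lemma harmonic_series:
  assumes sm: "summable (\<lambda>k. L2_nrm \<nu> (comb k (c k)) * sqrt (harmonic_dim \<nu> k))"
  shows "continuous_on Sph (\<lambda>x. \<Sum>k. comb k (c k) x)"
    and "j \<in> idx n \<Longrightarrow> coef (\<lambda>x. \<Sum>k. comb k (c k) x) n j = c n j"
    and "x \<in> Sph \<Longrightarrow> summable (\<lambda>k. comb k (c k) x)"
proof -
  note s = L2_inner_suminf[OF comb_continuous _ sm abs_comb_le]
  have "continuous_on Sph (\<lambda>x. 0)" by (rule continuous_on_const)
  then show "continuous_on Sph (\<lambda>x. \<Sum>k. comb k (c k) x)" by (rule s(1))
  show "x \<in> Sph \<Longrightarrow> summable (\<lambda>k. comb k (c k) x)"
    using abs_comb_le by (intro summable_comparison_test'[OF sm]) auto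
  assume j: "j \<in> idx n"
  have "(\<lambda>k. coef (comb k (c k)) n j) sums coef (\<lambda>x. \<Sum>k. comb k (c k) x) n j"
    unfolding coef_def by (rule s(2)[OF B_continuous[OF j]])
  moreover have "(\<lambda>k. coef (comb k (c k)) n j) = (\<lambda>k. if k = n then c k j else 0)"
    by (auto simp: coef_comb[OF j])
  ultimately show "coef (\<lambda>x. \<Sum>k. comb k (c k) x) n j = c n j"
    using sums_unique2[OF sums_single[of n "\<lambda>k. c k j"]] by simp
qed

text \<open>The series and \<open>w\<close> are continuous with equal coefficients, so they agree at
  every point. Agreement almost everywhere would not do, since the expansion is later evaluated at
  individual points of \<open>Y\<close>.\<close>

lemma continuous_expansion:
  assumes w: "continuous_on Sph w"
    and sm: "summable (\<lambda>k. L2_nrm \<nu> (harmonic_proj \<nu> k w) * sqrt (harmonic_dim \<nu> k))"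
    and x: "x \<in> Sph"
  shows "(\<lambda>k. harmonic_proj \<nu> k w x) sums w x"
proof -
  have eq: "harmonic_proj \<nu> k w = comb k (coef w k)" for k by (rule harmonic_proj_eq[OF w])
  note s = harmonic_series[OF sm[unfolded eq]]
  have "w x - (\<Sum>k. comb k (coef w k) x) = 0"
  proof (rule continuous_eq_0[OF _ _ x])
    show "continuous_on Sph (\<lambda>x. w x - (\<Sum>k. comb k (coef w k) x))"
      by (intro continuous_intros w s)
    show "coef (\<lambda>x. w x - (\<Sum>k. comb k (coef w k) x)) n j = 0" if "j \<in> idx n" for n j
      using that by (simp add: coef_diff w s)
  qed
  then show ?thesis using summable_sums[OF s(3)[OF x]] by (simp add: eq)
qed

end

section \<open>Cauchy-Schwarz for infinite series\<close>

lemma suminf_mult_le_sqrt: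
  fixes f g :: "nat \<Rightarrow> real"
  assumes f: "\<And>n. 0 \<le> f n" "summable (\<lambda>n. (f n)\<^sup>2)"
    and g: "\<And>n. 0 \<le> g n" "summable (\<lambda>n. (g n)\<^sup>2)"
  shows "summable (\<lambda>n. f n * g n)"
    and "(\<Sum>n. f n * g n) \<le> sqrt (\<Sum>n. (f n)\<^sup>2) * sqrt (\<Sum>n. (g n)\<^sup>2)"
proof -
  have "f n * g n \<le> (f n)\<^sup>2 + (g n)\<^sup>2" for n
  proof -
    have "2 * (f n * g n) \<le> (f n)\<^sup>2 + (g n)\<^sup>2"
      using sum_squares_bound[of "f n" "g n"] by simp
    moreover have "0 \<le> f n * g n" using f g by simp
    ultimately show ?thesis by linarith
  qed
  then show s: "summable (\<lambda>n. f n * g n)"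
    using f g by (intro summable_comparison_test'[OF summable_add[OF f(2) g(2)]]) simp
  show "(\<Sum>n. f n * g n) \<le> sqrt (\<Sum>n. (f n)\<^sup>2) * sqrt (\<Sum>n. (g n)\<^sup>2)"
  proof (rule suminf_le_const[OF s])
    fix n
    have "(\<Sum>k<n. f k * g k) \<le> L2_set f {..<n} * L2_set g {..<n}"
      using L2_set_mult_ineq[of f g "{..<n}"] f g by simp
    also have "\<dots> \<le> sqrt (\<Sum>n. (f n)\<^sup>2) * sqrt (\<Sum>n. (g n)\<^sup>2)"
      unfolding L2_set_def using f g
      by (intro mult_mono real_sqrt_le_mono sum_le_suminf real_sqrt_ge_zero sum_nonneg suminf_nonneg) auto
    finally show "(\<Sum>k<n. f k * g k) \<le> sqrt (\<Sum>n. (f n)\<^sup>2) * sqrt (\<Sum>n. (g n)\<^sup>2)" .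
  qed
qed

section \<open>The error estimate\<close>

context harmonic_basis
begin

abbreviation proj_nrm :: "(real ^ 'n \<Rightarrow> real) \<Rightarrow> nat \<Rightarrow> real" where
  "proj_nrm f n \<equiv> L2_nrm \<nu> (harmonic_proj \<nu> n f)"

lemma L2_nrm_nonneg: "0 \<le> L2_nrm \<nu> f"
  unfolding L2_nrm_def L2_inner_def by simp

lemma proj_nrm_eq:
  assumes "continuous_on Sph f"
  shows "proj_nrm f n = L2_set (coef f n) (idx n)"
  using harmonic_proj_eq[OF assms] by (simp add: L2_nrm_comb)

text \<open>A crude triangle inequality, enough to see that finiteness of the native norm passes to
  differences.\<close>

lemma proj_nrm_diff_le:
  assumes "continuous_on Sph f" "continuous_on Sph g"
  shows "(proj_nrm (\<lambda>x. f x - g x) n)\<^sup>2 \<le> 2 * (proj_nrm f n)\<^sup>2 + 2 * (proj_nrm g n)\<^sup>2"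
proof -
  have c: "continuous_on Sph (\<lambda>x. f x - g x)" using assms by (intro continuous_intros)
  have "(\<Sum>j\<in>idx n. (coef f n j - coef g n j)\<^sup>2)
      \<le> (\<Sum>j\<in>idx n. 2 * (coef f n j)\<^sup>2 + 2 * (coef g n j)\<^sup>2)"
  proof (rule sum_mono)
    fix j
    have "(coef f n j - coef g n j)\<^sup>2 + (coef f n j + coef g n j)\<^sup>2
        = 2 * (coef f n j)\<^sup>2 + 2 * (coef g n j)\<^sup>2"
      by (simp add: power2_eq_square algebra_simps)
    then show "(coef f n j - coef g n j)\<^sup>2 \<le> 2 * (coef f n j)\<^sup>2 + 2 * (coef g n j)\<^sup>2"
      by (metis le_add_same_cancel1 zero_le_power2)
  qed
  moreover have "(\<Sum>j\<in>idx n. (coef (\<lambda>x. f x - g x) n j)\<^sup>2)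
      = (\<Sum>j\<in>idx n. (coef f n j - coef g n j)\<^sup>2)"
    using assms by (intro sum.cong refl) (simp add: coef_diff)
  ultimately show ?thesis
    using assms c by (simp add: proj_nrm_eq L2_set_def sum_nonneg sum.distrib sum_distrib_left)
qed

lemma abs_harmonic_proj_le:
  assumes "continuous_on Sph f" "x \<in> Sph"
  shows "\<bar>harmonic_proj \<nu> n f x\<bar> \<le> proj_nrm f n * sqrt (harmonic_dim \<nu> n)"
  using abs_comb_le[OF assms(2)] harmonic_proj_eq[OF assms(1)] by simp

text \<open>By the addition formula the \<open>n\<close>-th term is the harmonic with coordinates
  \<open>a n * B n j y\<close>, of norm \<open>a n * sqrt d\<^sub>n\<close>. Its sup bound is thus
  \<open>a n * d\<^sub>n\<close>, which is assumed summable.\<close>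

lemma zonal_series:
  assumes a: "\<And>n. a n > 0" "summable (\<lambda>n. real (harmonic_dim \<nu> n) * a n)"
    and \<phi>: "\<And>x y. x \<in> Sph \<Longrightarrow> y \<in> Sph \<Longrightarrow> (\<lambda>n. a n * poly (C n) (x \<bullet> y)) sums \<phi> (geodist x y)"
    and y: "y \<in> Sph"
  shows "continuous_on Sph (\<lambda>x. \<phi> (geodist x y))"
    and "j \<in> idx n \<Longrightarrow> coef (\<lambda>x. \<phi> (geodist x y)) n j = a n * B n j y"
proof -
  define c where "c k = (\<lambda>j. a k * B k j y)" for k
  have nrm: "L2_nrm \<nu> (comb k (c k)) = a k * sqrt (harmonic_dim \<nu> k)" for k
    using L2_set_right_distrib[of "a k" "\<lambda>j. B k j y" "idx k"] L2_set_B[OF y, of k] a(1)[of k]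
    by (simp add: L2_nrm_comb c_def)
  have sm: "summable (\<lambda>k. L2_nrm \<nu> (comb k (c k)) * sqrt (harmonic_dim \<nu> k))"
    using a(2) by (simp add: nrm mult_ac)
  note s = harmonic_series[OF sm]
  have eq: "\<phi> (geodist x y) = (\<Sum>k. comb k (c k) x)" if x: "x \<in> Sph" for x
  proof -
    have "comb k (c k) x = a k * poly (C k) (x \<bullet> y)" for k
      using kernel_eq[OF x y, of k] by (simp add: comb_def c_def sum_distrib_left mult.assoc)
    then show ?thesis using \<phi>[OF x y] by (simp add: sums_iff)
  qed
  show "continuous_on Sph (\<lambda>x. \<phi> (geodist x y))"
    using s(1) by (subst continuous_on_cong[OF refl eq])
  assume j: "j \<in> idx n"
  have "coef (\<lambda>x. \<phi> (geodist x y)) n j = coef (\<lambda>x. \<Sum>k. comb k (c k) x) n j"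
    unfolding coef_def by (rule L2_inner_cong[OF eq])
  then show "coef (\<lambda>x. \<phi> (geodist x y)) n j = a n * B n j y"
    using s(2)[OF j] by (simp add: c_def)
qed

text \<open>This places the interpolant in the native space: its squared component of degree
  \<open>n\<close> is of order \<open>(a n)\<^sup>2 * d\<^sub>n\<close>, so the weight
  \<open>inverse (a n)\<close> leaves the summable \<open>d\<^sub>n * a n\<close>.\<close>

lemma zonal_combination:
  fixes S :: "real ^ 'n \<Rightarrow> real"
  assumes a: "\<And>n. a n > 0" "summable (\<lambda>n. real (harmonic_dim \<nu> n) * a n)"
    and \<phi>: "\<And>x y. x \<in> Sph \<Longrightarrow> y \<in> Sph \<Longrightarrow> (\<lambda>n. a n * poly (C n) (x \<bullet> y)) sums \<phi> (geodist x y)"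
    and Y: "finite Y" "Y \<subseteq> Sph"
    and S: "\<And>x. x \<in> Sph \<Longrightarrow> S x = (\<Sum>y\<in>Y. \<alpha> y * \<phi> (geodist x y))"
  shows "continuous_on Sph S"
    and "summable (\<lambda>n. inverse (a n) * (proj_nrm S n)\<^sup>2)"
proof -
  have z: "continuous_on Sph (\<lambda>x. \<phi> (geodist x y))"
    "j \<in> idx n \<Longrightarrow> coef (\<lambda>x. \<phi> (geodist x y)) n j = a n * B n j y" if "y \<in> Sph" for y n j
    using zonal_series[of a \<phi> y] a \<phi> that by blast+
  have zc: "continuous_on Sph (\<lambda>x. \<alpha> y * \<phi> (geodist x y))" if "y \<in> Y" for y
    using that Y by (intro continuous_intros z(1)) auto
  show Sc: "continuous_on Sph S"
    using zc by (subst continuous_on_cong[OF refl S]) (auto intro: continuous_on_sum)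
  \<comment> \<open>\<open>K\<close> collects what does not depend on \<open>n\<close>:
    Cauchy-Schwarz over \<open>Y\<close> yields the squared coefficients, and each point of
    \<open>Y\<close> contributes one \<open>d\<^sub>n\<close>.\<close>
  define K where "K = (\<Sum>y\<in>Y. (\<alpha> y)\<^sup>2) * real (card Y)"
  have coefS: "coef S n j = a n * (\<Sum>y\<in>Y. \<alpha> y * B n j y)" if j: "j \<in> idx n" for n j
  proof -
    have "coef S n j = coef (\<lambda>x. \<Sum>y\<in>Y. \<alpha> y * \<phi> (geodist x y)) n j"
      unfolding coef_def by (rule L2_inner_cong[OF S])
    also have "\<dots> = (\<Sum>y\<in>Y. \<alpha> y * coef (\<lambda>x. \<phi> (geodist x y)) n j)"
      unfolding coef_def using zc B_continuous[OF j] by (simp add: L2_inner_sum L2_inner_scale)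
    also have "\<dots> = (\<Sum>y\<in>Y. \<alpha> y * (a n * B n j y))"
      using Y z(2)[OF _ j] by (intro sum.cong refl) auto
    finally show ?thesis by (simp add: sum_distrib_left mult_ac)
  qed
  have bound: "(proj_nrm S n)\<^sup>2 \<le> (a n)\<^sup>2 * (K * real (harmonic_dim \<nu> n))" for n
  proof -
    have "(proj_nrm S n)\<^sup>2 = (\<Sum>j\<in>idx n. (a n)\<^sup>2 * (\<Sum>y\<in>Y. \<alpha> y * B n j y)\<^sup>2)"
      using coefS by (simp add: proj_nrm_eq[OF Sc] L2_set_def sum_nonneg power_mult_distrib)
    also have "\<dots> \<le> (\<Sum>j\<in>idx n. (a n)\<^sup>2 * ((\<Sum>y\<in>Y. (\<alpha> y)\<^sup>2) * (\<Sum>y\<in>Y. (B n j y)\<^sup>2)))"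
      by (intro sum_mono mult_left_mono Cauchy_Schwarz_ineq_sum) simp
    also have "\<dots> = (a n)\<^sup>2 * ((\<Sum>y\<in>Y. (\<alpha> y)\<^sup>2) * (\<Sum>j\<in>idx n. \<Sum>y\<in>Y. (B n j y)\<^sup>2))"
      by (simp only: sum_distrib_left)
    also have "(\<Sum>j\<in>idx n. \<Sum>y\<in>Y. (B n j y)\<^sup>2) = (\<Sum>y\<in>Y. \<Sum>j\<in>idx n. (B n j y)\<^sup>2)"
      by (rule sum.swap)
    also have "\<dots> = (\<Sum>y\<in>Y. real (harmonic_dim \<nu> n))"
    proof (rule sum.cong)
      fix y assume "y \<in> Y"
      then show "(\<Sum>j\<in>idx n. (B n j y)\<^sup>2) = real (harmonic_dim \<nu> n)"
        using L2_set_B[of y n] Y by (auto simp: L2_set_def)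
    qed simp
    finally show ?thesis by (simp add: K_def mult_ac)
  qed
  show "summable (\<lambda>n. inverse (a n) * (proj_nrm S n)\<^sup>2)"
  proof (rule summable_comparison_test'[OF summable_mult[OF a(2), of K], of 0])
    fix n
    have "inverse (a n) * (proj_nrm S n)\<^sup>2 \<le> inverse (a n) * ((a n)\<^sup>2 * (K * real (harmonic_dim \<nu> n)))"
      using bound[of n] a(1)[of n] by (intro mult_left_mono) auto
    also have "\<dots> = K * (real (harmonic_dim \<nu> n) * a n)"
      using a(1)[of n] by (simp add: power2_eq_square field_simps)
    finally show "norm (inverse (a n) * (proj_nrm S n)\<^sup>2) \<le> K * (real (harmonic_dim \<nu> n) * a n)"
      using a(1)[of n] by simp
  qed
qed

text \<open>Cauchy-Schwarz with \<open>sqrt (a n)\<close> moved to one factor and its inverse to the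
  other. The weight \<open>w\<close> stays general: 1 gives absolute convergence of the expansion,
  \<open>lam\<close> the final bound.\<close>

lemma weighted_series:
  assumes a: "\<And>n. a n > 0" and w: "\<And>n. 0 \<le> w n"
    and d: "summable (\<lambda>n. real (harmonic_dim \<nu> n) * (w n)\<^sup>2 * a n)"
    and v: "summable (\<lambda>n. inverse (a n) * (proj_nrm v n)\<^sup>2)"
  shows "summable (\<lambda>n. w n * (proj_nrm v n * sqrt (harmonic_dim \<nu> n)))"
    and "(\<Sum>n. w (N + n) * (proj_nrm v (N + n) * sqrt (harmonic_dim \<nu> (N + n))))
      \<le> sqrt (\<Sum>n. real (harmonic_dim \<nu> (N + n)) * (w (N + n))\<^sup>2 * a (N + n)) * native_nrm \<nu> a v"
proof -
  define f where "f n = sqrt (real (harmonic_dim \<nu> n) * (w n)\<^sup>2 * a n)" for n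
  define g where "g n = sqrt (inverse (a n)) * proj_nrm v n" for n
  have f2: "(f n)\<^sup>2 = real (harmonic_dim \<nu> n) * (w n)\<^sup>2 * a n" for n
    using a[of n] by (simp add: f_def)
  have g2: "(g n)\<^sup>2 = inverse (a n) * (proj_nrm v n)\<^sup>2" for n
    using a[of n] by (simp add: g_def power_mult_distrib)
  have f0: "0 \<le> f n" and g0: "0 \<le> g n" for n
    using a[of n] by (simp_all add: f_def g_def L2_nrm_nonneg)
  have fg: "f n * g n = w n * (proj_nrm v n * sqrt (harmonic_dim \<nu> n))" for n
  proof -
    have "sqrt (a n) * sqrt (inverse (a n)) = 1"
      using a[of n] by (simp flip: real_sqrt_mult)
    then show ?thesis using w[of n]
      by (simp add: f_def g_def real_sqrt_mult mult_ac)
  qed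
  show "summable (\<lambda>n. w n * (proj_nrm v n * sqrt (harmonic_dim \<nu> n)))"
    using suminf_mult_le_sqrt(1)[of f g] f0 g0 d v by (simp add: f2 g2 fg)
  have sf: "summable (\<lambda>n. (f (N + n))\<^sup>2)" and sg: "summable (\<lambda>n. (g (N + n))\<^sup>2)"
    using summable_ignore_initial_segment[OF d, of N] summable_ignore_initial_segment[OF v, of N]
    by (simp_all add: f2 g2 add.commute)
  have "(\<Sum>n. f (N + n) * g (N + n)) \<le> sqrt (\<Sum>n. (f (N + n))\<^sup>2) * sqrt (\<Sum>n. (g (N + n))\<^sup>2)"
    by (rule suminf_mult_le_sqrt(2)) (auto simp: f0 g0 sf sg)
  also have "\<dots> \<le> sqrt (\<Sum>n. (f (N + n))\<^sup>2) * sqrt (\<Sum>n. (g n)\<^sup>2)"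
  proof (intro mult_left_mono real_sqrt_le_mono)
    have "(\<Sum>n. (g n)\<^sup>2) = (\<Sum>n. (g (n + N))\<^sup>2) + (\<Sum>n<N. (g n)\<^sup>2)"
      using v by (intro suminf_split_initial_segment) (simp add: g2)
    then show "(\<Sum>n. (g (N + n))\<^sup>2) \<le> (\<Sum>n. (g n)\<^sup>2)"
      by (simp add: add.commute sum_nonneg)
    show "0 \<le> sqrt (\<Sum>n. (f (N + n))\<^sup>2)"
      using sf by (intro real_sqrt_ge_zero suminf_nonneg) auto
  qed
  finally show "(\<Sum>n. w (N + n) * (proj_nrm v (N + n) * sqrt (harmonic_dim \<nu> (N + n))))
      \<le> sqrt (\<Sum>n. real (harmonic_dim \<nu> (N + n)) * (w (N + n))\<^sup>2 * a (N + n)) * native_nrm \<nu> a v"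
    by (simp add: fg f2 g2 native_nrm_def)
qed

lemma harmonic_proj_partial_sum:
  assumes v: "continuous_on Sph v"
  shows "harmonic_proj \<nu> n (\<lambda>x. \<Sum>k<N. harmonic_proj \<nu> k v x) x
       = (if n < N then harmonic_proj \<nu> n v x else 0)"
proof -
  have eq: "harmonic_proj \<nu> k v = comb k (coef v k)" for k by (rule harmonic_proj_eq[OF v])
  have "continuous_on Sph (\<lambda>x. \<Sum>k<N. comb k (coef v k) x)"
    by (intro continuous_intros comb_continuous)
  then have "harmonic_proj \<nu> n (\<lambda>x. \<Sum>k<N. comb k (coef v k) x) x
      = (\<Sum>j\<in>idx n. coef (\<lambda>x. \<Sum>k<N. comb k (coef v k) x) n j * B n j x)"
    by (simp only: harmonic_proj_eq comb_def[of n _ x])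
  also have "\<dots> = (\<Sum>j\<in>idx n. (if n < N then coef v n j else 0) * B n j x)"
    by (intro sum.cong refl) (simp only: coef_partial_sum)
  also have "\<dots> = (if n < N then comb n (coef v n) x else 0)"
    by (simp add: comb_def)
  finally show ?thesis by (simp only: eq)
qed

lemma pseudodiff_bound:
  assumes a: "\<And>n. a n > 0" "summable (\<lambda>n. real (harmonic_dim \<nu> n) * a n)"
    and lam: "\<And>n. 0 \<le> lam n" "mono lam"
    and slam: "summable (\<lambda>n. real (harmonic_dim \<nu> n) * (lam n)\<^sup>2 * a n)"
    and E: "0 \<le> E"
      "\<And>p. p \<in> sphere_polys N \<Longrightarrow> Linf_nrm \<nu> (pseudodiff \<nu> lam p) \<le> E * lam N * Linf_nrm \<nu> p"
    and N: "N > 0" and Y: "finite Y" "Y \<noteq> {}" "Y \<subseteq> Sph"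
    and fill: "fill_distance Y \<le> 1 / (2 * real N)"
    and v: "continuous_on Sph v" "summable (\<lambda>n. inverse (a n) * (proj_nrm v n)\<^sup>2)"
    and v0: "\<And>y. y \<in> Y \<Longrightarrow> v y = 0" and x: "x \<in> Sph"
  shows "\<bar>pseudodiff \<nu> lam v x\<bar> \<le> (1 + 2 * E)
      * sqrt (\<Sum>n. real (harmonic_dim \<nu> (N + n)) * (lam (N + n))\<^sup>2 * a (N + n)) * native_nrm \<nu> a v"
proof -
  define t where "t n = proj_nrm v n * sqrt (harmonic_dim \<nu> n)" for n
  define p where "p = (\<lambda>x. \<Sum>k<N. harmonic_proj \<nu> k v x)"
  define R where "R = (\<Sum>n. lam (N + n) * t (N + n))"
  have eq: "harmonic_proj \<nu> k v = comb k (coef v k)" for k by (rule harmonic_proj_eq[OF v(1)])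
  have T: "\<bar>harmonic_proj \<nu> n v z\<bar> \<le> t n" if "z \<in> Sph" for n z
    unfolding t_def using v(1) that by (rule abs_harmonic_proj_le)
  have st: "summable t"
    using weighted_series(1)[of a "\<lambda>_. 1" v] a v(2) by (simp add: t_def[abs_def])
  have slt: "summable (\<lambda>n. lam n * t n)"
    using weighted_series(1)[of a lam v] a lam slam v(2) by (simp add: t_def[abs_def])
  have st': "summable (\<lambda>n. t (N + n))" and slt': "summable (\<lambda>n. lam (N + n) * t (N + n))"
    using summable_ignore_initial_segment[OF st, of N] summable_ignore_initial_segment[OF slt, of N]
    by (simp_all add: add.commute)
  \<comment> \<open>\<open>p\<close> has degree below \<open>N\<close> but is treated as one of
    degree \<open>N\<close>: the fill distance is matched to \<open>N\<close>, and
    \<open>lam N\<close> is at most every symbol in the tail.\<close>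
  have p: "p \<in> sphere_polys N"
    unfolding p_def eq by (intro sphere_polys_sum comb_sphere_polys) auto
  have pc: "continuous_on Sph p" by (rule sphere_polys_continuous[OF p])
  have pY: "\<bar>p y\<bar> \<le> (\<Sum>n. t (N + n))" if y: "y \<in> Y" for y
  proof -
    have yS: "y \<in> Sph" using y Y by blast
    have "(\<lambda>n. harmonic_proj \<nu> n v y) sums v y"
      using continuous_expansion[OF v(1) _ yS] st by (simp add: t_def[abs_def])
    then have "(\<lambda>n. harmonic_proj \<nu> (n + N) v y) sums (v y - p y)"
      unfolding p_def by (rule sums_iff_shift'[THEN iffD2])
    then have "(\<lambda>n. harmonic_proj \<nu> (N + n) v y) sums (- p y)"
      by (simp add: v0[OF y] add.commute)
    then have "\<bar>p y\<bar> = \<bar>\<Sum>n. harmonic_proj \<nu> (N + n) v y\<bar>"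
      by (simp add: sums_iff)
    also have "\<dots> \<le> (\<Sum>n. t (N + n))"
      using norm_suminf_le[of "\<lambda>n. harmonic_proj \<nu> (N + n) v y", OF _ st'] T[OF yS] by simp
    finally show ?thesis .
  qed
  have p_le: "\<bar>p z\<bar> \<le> 2 * (\<Sum>n. t (N + n))" if "z \<in> Sph" for z
    using sphere_polys_norming_set[OF N p Y fill pY that] .
  \<comment> \<open>A finite sum is continuous, so the essential supremum bound applies at the given
    point.\<close>
  have Lp: "pseudodiff \<nu> lam p z = (\<Sum>n<N. lam n * harmonic_proj \<nu> n v z)" for z
  proof -
    have "pseudodiff \<nu> lam p z = (\<Sum>n<N. lam n * harmonic_proj \<nu> n p z)"
      unfolding pseudodiff_def using harmonic_proj_partial_sum[OF v(1)]
      by (intro suminf_finite) (auto simp: p_def)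
    then show ?thesis
      using harmonic_proj_partial_sum[OF v(1)] by (simp add: p_def)
  qed
  have "continuous_on Sph (\<lambda>z. \<Sum>n<N. lam n * harmonic_proj \<nu> n v z)"
    unfolding eq by (intro continuous_intros comb_continuous)
  then have "continuous_on Sph (pseudodiff \<nu> lam p)"
    by (simp only: Lp[abs_def])
  then have "\<bar>pseudodiff \<nu> lam p x\<bar> \<le> Linf_nrm \<nu> (pseudodiff \<nu> lam p)"
    using x by (rule le_Linf_nrm)
  also have "\<dots> \<le> E * lam N * Linf_nrm \<nu> p" by (rule E(2)[OF p])
  also have "\<dots> \<le> E * lam N * (2 * (\<Sum>n. t (N + n)))"
    using Linf_nrm_le[OF pc p_le] E lam by (intro mult_left_mono) auto
  also have "\<dots> = 2 * E * (\<Sum>n. lam N * t (N + n))"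
    using suminf_mult[OF st', of "lam N"] by simp
  also have "\<dots> \<le> 2 * E * R"
  proof -
    have t0: "0 \<le> t n" for n by (simp add: t_def L2_nrm_nonneg)
    \<comment> \<open>Monotonicity of the symbol puts the contribution of \<open>p\<close> under the
      same tail sum as the rest.\<close>
    have "(\<Sum>n. lam N * t (N + n)) \<le> R"
      unfolding R_def using lam(2) t0 st' slt'
      by (intro suminf_le mult_right_mono summable_mult) (auto simp: mono_def)
    then show ?thesis using E by (intro mult_left_mono) auto
  qed
  finally have low: "\<bar>pseudodiff \<nu> lam p x\<bar> \<le> 2 * E * R" .
  have bd: "\<bar>lam n * harmonic_proj \<nu> n v x\<bar> \<le> lam n * t n" for n
    using T[OF x] lam(1) by (simp add: abs_mult mult_left_mono)
  then have "summable (\<lambda>n. lam n * harmonic_proj \<nu> n v x)"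
    by (intro summable_comparison_test'[OF slt]) auto
  \<comment> \<open>The first \<open>N\<close> terms are exactly
    \<open>pseudodiff \<nu> lam p x\<close>, so the operator splits without an interchange of
    limits.\<close>
  then have "pseudodiff \<nu> lam v x
      = (\<Sum>n. lam (n + N) * harmonic_proj \<nu> (n + N) v x) + pseudodiff \<nu> lam p x"
    unfolding Lp unfolding pseudodiff_def by (rule suminf_split_initial_segment)
  moreover have "\<bar>\<Sum>n. lam (n + N) * harmonic_proj \<nu> (n + N) v x\<bar> \<le> R"
    using norm_suminf_le[of "\<lambda>n. lam (n + N) * harmonic_proj \<nu> (n + N) v x", OF _ slt'] bd
    by (simp add: R_def add.commute)
  ultimately have "\<bar>pseudodiff \<nu> lam v x\<bar> \<le> (1 + 2 * E) * R"
    using low by (simp add: algebra_simps)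
  also have "\<dots> \<le> (1 + 2 * E) * (sqrt (\<Sum>n. real (harmonic_dim \<nu> (N + n)) * (lam (N + n))\<^sup>2 * a (N + n))
      * native_nrm \<nu> a v)"
    using weighted_series(2)[of a lam v N] a lam slam v(2) E
    by (intro mult_left_mono) (auto simp: R_def t_def)
  finally show ?thesis by (simp only: mult.assoc)
qed

end

section \<open>Monotonicity of the symbol, the sign of \<open>E\<close>, and finiteness of the
  native norm of the error\<close>

theorem theorem2p5:
  fixes d N :: nat
    and \<nu> :: "(real ^ 'n) measure"
    and B :: "nat \<Rightarrow> nat \<Rightarrow> real ^ 'n \<Rightarrow> real"
    and C :: "nat \<Rightarrow> real poly"
    and a lam :: "nat \<Rightarrow> real"
    and \<phi> :: "real \<Rightarrow> real"
    and Y :: "(real ^ 'n) set"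
    and f S :: "real ^ 'n \<Rightarrow> real"
    and s E :: real
  assumes "d \<ge> 1" and "CARD('n) = d + 1"
    and "rotation_invariant_prob \<nu>"
    and "\<And>n. harmonic_onb \<nu> n (B n)"
    and "\<And>n. normalised_gegenbauer \<nu> n (B n) (C n)"
    and "\<And>n. a n > 0"
    and "summable (\<lambda>n. real (harmonic_dim \<nu> n) * a n)"
    and "\<And>x y :: real ^ 'n. x \<in> sphere 0 1 \<Longrightarrow> y \<in> sphere 0 1 \<Longrightarrow>
           (\<lambda>n. a n * poly (C n) (x \<bullet> y)) sums \<phi> (geodist x y)"
    and "N > 0"
    and "finite Y" and "Y \<noteq> {}" and "Y \<subseteq> sphere 0 1"
    and "fill_distance Y \<le> 1 / (2 * real N)"
    and "f \<in> native_space \<nu> a"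
    and "spline_interpolant \<phi> Y f S"
    and "s > 0"
    and "\<And>n. lam n = (real n * (real d + real n - 2)) powr s"
    and "summable (\<lambda>n. real (harmonic_dim \<nu> n) * (lam n)\<^sup>2 * a n)"
    and "\<And>n p. p \<in> sphere_polys n \<Longrightarrow>
           Linf_nrm \<nu> (pseudodiff \<nu> lam p) \<le> E * lam n * Linf_nrm \<nu> p"
  shows "\<forall>x\<in>sphere 0 1. \<bar>pseudodiff \<nu> lam (\<lambda>z. f z - S z) x\<bar>
           \<le> (1 + 2 * E)
             * sqrt (\<Sum>n. real (harmonic_dim \<nu> (N + n)) * (lam (N + n))\<^sup>2 * a (N + n))
             * native_nrm \<nu> a (\<lambda>z. f z - S z)"
proof -
  interpret harmonic_basis \<nu> B C
    by unfold_locales (use assms(1-5) in auto)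
  have lam0: "0 \<le> lam n" for n by (simp add: assms(17))
  have lam_mono: "mono lam"
  proof (rule monoI)
    fix m n :: nat assume mn: "m \<le> n"
    show "lam m \<le> lam n"
    \<comment> \<open>For \<open>m = 0\<close> and \<open>d = 1\<close> the factor
      \<open>d + m - 2\<close> is negative, so products cannot be compared factor by factor; instead
      \<open>lam 0 = 0\<close> because \<open>0 powr s = 0\<close>.\<close>
    proof (cases "m = 0")
      case True
      then show ?thesis using lam0[of n] by (simp add: assms(17))
    next
      case False
      then have "0 \<le> real d + real m - 2" using assms(1) by linarith
      then have "real m * (real d + real m - 2) \<le> real n * (real d + real n - 2)"
        and "0 \<le> real m * (real d + real m - 2)"
        using mn by (auto intro!: mult_mono)
      then show ?thesis unfolding assms(17) using assms(16) by (intro powr_mono2) auto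
    qed
  qed
  \<comment> \<open>The assumed inequality is tested on the constant 1 regarded as a polynomial of
    degree 2. As \<open>lam 0\<close> vanishes, and \<open>lam 1\<close> too when
    \<open>d = 1\<close>, this is the lowest degree with positive symbol for every
    \<open>d\<close>.\<close>
  have E: "0 \<le> E"
  proof -
    define q :: "real ^ 'n \<Rightarrow> real" where "q = (\<lambda>x. if x \<in> sphere 0 1 then 1 else 0)"
    have q: "q \<in> sphere_polys 2" unfolding q_def by (rule sphere_polys_const)
    have qc: "continuous_on Sph q" by (rule sphere_polys_continuous[OF q])
    obtain x0 where x0: "x0 \<in> Sph" using sphere_nonempty by blast
    have Lq: "pseudodiff \<nu> lam q x = (\<Sum>n<Suc 2. lam n * harmonic_proj \<nu> n q x)" for x
    proof -
      have "harmonic_proj \<nu> n q x = 0" if n: "n \<notin> {..<Suc 2}" for n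
      proof -
        have "coef q n j = 0" if j: "j \<in> idx n" for j
        proof -
          have "2 < n" using n by simp
          then have "L2_inner \<nu> (B n j) q = 0"
            using B_harmonics[OF j] q unfolding harmonics_def by blast
          then show ?thesis by (simp add: coef_def L2_inner_commute)
        qed
        then show ?thesis by (simp add: harmonic_proj_eq[OF qc] comb_def)
      qed
      then show ?thesis unfolding pseudodiff_def by (intro suminf_finite) auto
    qed
    have "continuous_on Sph (pseudodiff \<nu> lam q)"
      unfolding Lq[abs_def] harmonic_proj_eq[OF qc] by (intro continuous_intros comb_continuous)
    then have "0 \<le> Linf_nrm \<nu> (pseudodiff \<nu> lam q)"
      using le_Linf_nrm[OF _ x0] abs_ge_zero order_trans by blast
    also have "\<dots> \<le> E * lam 2 * Linf_nrm \<nu> q" by (rule assms(19)[OF q])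
    finally have "0 \<le> E * (lam 2 * Linf_nrm \<nu> q)" by (simp only: mult.assoc)
    moreover have "0 < lam 2 * Linf_nrm \<nu> q"
    proof (rule mult_pos_pos)
      show "0 < lam 2" using assms(1) by (simp add: assms(17))
      show "0 < Linf_nrm \<nu> q" using le_Linf_nrm[OF qc x0] x0 by (simp add: q_def)
    qed
    ultimately show ?thesis by (simp add: zero_le_mult_iff)
  qed
  obtain \<alpha> where S: "\<And>x. x \<in> Sph \<Longrightarrow> S x = (\<Sum>y\<in>Y. \<alpha> y * \<phi> (geodist x y))"
    and SY: "\<And>y. y \<in> Y \<Longrightarrow> S y = f y"
    using assms(15) unfolding spline_interpolant_def by blast
  have f: "continuous_on Sph f" "summable (\<lambda>n. inverse (a n) * (proj_nrm f n)\<^sup>2)"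
    using assms(14) by (simp_all add: native_space_def)
  have Sn: "continuous_on Sph S" "summable (\<lambda>n. inverse (a n) * (proj_nrm S n)\<^sup>2)"
    using zonal_combination[of a \<phi> Y S \<alpha>] assms(6,7,8,10,12) S by blast+
  have vc: "continuous_on Sph (\<lambda>z. f z - S z)"
    using f(1) Sn(1) by (intro continuous_intros)
  have vs: "summable (\<lambda>n. inverse (a n) * (proj_nrm (\<lambda>z. f z - S z) n)\<^sup>2)"
  proof (rule summable_comparison_test'[OF summable_add[OF summable_mult[OF f(2), of 2] summable_mult[OF Sn(2), of 2]], of 0])
    fix n
    have "inverse (a n) * (proj_nrm (\<lambda>z. f z - S z) n)\<^sup>2
        \<le> inverse (a n) * (2 * (proj_nrm f n)\<^sup>2 + 2 * (proj_nrm S n)\<^sup>2)"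
      using proj_nrm_diff_le[OF f(1) Sn(1), of n] assms(6)[of n] by (intro mult_left_mono) auto
    then show "norm (inverse (a n) * (proj_nrm (\<lambda>z. f z - S z) n)\<^sup>2)
        \<le> 2 * (inverse (a n) * (proj_nrm f n)\<^sup>2) + 2 * (inverse (a n) * (proj_nrm S n)\<^sup>2)"
      using assms(6)[of n] by (simp add: algebra_simps)
  qed
  show ?thesis
  proof
    fix x :: "real ^ 'n" assume x: "x \<in> sphere 0 1"
    show "\<bar>pseudodiff \<nu> lam (\<lambda>z. f z - S z) x\<bar>
           \<le> (1 + 2 * E)
             * sqrt (\<Sum>n. real (harmonic_dim \<nu> (N + n)) * (lam (N + n))\<^sup>2 * a (N + n))
             * native_nrm \<nu> a (\<lambda>z. f z - S z)"
      by (rule pseudodiff_bound[OF assms(6,7) lam0 lam_mono assms(18) E assms(19,9,10,11,12,13) vc vs _ x])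
        (simp_all add: SY)
  qed
qed

end
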